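(* Let $A_1,A_2\in\mathbb{R}^{n\times n}$, $e_1,e_2,c\in\mathbb{R}^n$ and $f\in\mathbb{R}$, and consider the bimodal piecewise affine system determined by these data (see context). Suppose there exists a $3\times3$ lower triangular matrix $M$ with positive diagonal elements such that $$\begin{bmatrix}c^T\\ c^TA_1\\ c^TA_1^2\end{bmatrix}=M\begin{bmatrix}c^T\\ c^TA_2\\ c^TA_2^2\end{bmatrix},\qquad \begin{bmatrix}f\\ c^Te_1\\ c^TA_1e_1\end{bmatrix}\succ M\begin{bmatrix}f\\ c^Te_2\\ c^TA_2e_2\end{bmatrix}.$$ Let $\Omega$ be the set of all $\xi\in\mathbb{R}^n$ such that $$\begin{bmatrix}c^T\\ c^TA_j\\ c^TA_j^2\end{bmatrix}\xi+\begin{bmatrix}f\\ c^Te_j\\ c^TA_je_j\end{bmatrix}=0\quad\text{and}\quad(-1)^k\left(c^TA_k^2\xi+c^TA_ke_k\right)<0$$ for some $k,j\in\{1,2\}$ with $k\neq j$. Then right-uniqueness of Filippov solutions holds at all states in $\mathbb{R}^n\setminus\Omega$, i.e. for every $\xi\in\mathbb{R}^n\setminus\Omega$, every Filippov solution for the initial state $\xi$ is right-unique.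
   Context: Define the set-valued mapping $G(x)=\{A_1x+e_1\}$ if $c^Tx+f<0$, $G(x)=\operatorname{conv}\{A_1x+e_1,A_2x+e_2\}$ if $c^Tx+f=0$, $G(x)=\{A_2x+e_2\}$ if $c^Tx+f>0$. A function $x:\mathbb{R}\to\mathbb{R}^n$, absolutely continuous on every compact interval, is a Filippov solution for the initial state $\xi$ if $x(0)=\xi$ and $\dot x(t)\in G(x(t))$ for almost all $t\in\mathbb{R}$. A Filippov solution $x$ for the initial state $\xi$ is right-unique if for any Filippov solution $x'$ for the initial state $\xi$ there exists $\epsilon>0$ such that $x(t)=x'(t)$ for all $t\in[0,\epsilon)$. For a vector $v$, $v\succ0$ means $v$ is nonzero and its first nonzero entry is positive; $v\succ w$ means $v-w\succ0$. *)

theory Defs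
  imports "HOL-Analysis.Analysis"
begin

text \<open>
  The two modes of a bimodal system are given by families indexed by natural numbers,
  of which only the members with index 1 and 2 are ever used.
\<close>

definition filippov_map ::
  "(nat \<Rightarrow> real ^ 'n ^ 'n) \<Rightarrow> (nat \<Rightarrow> real ^ 'n) \<Rightarrow> real ^ 'n \<Rightarrow> real \<Rightarrow> real ^ 'n \<Rightarrow> (real ^ 'n) set"
  where "filippov_map A e c f x =
    (if c \<bullet> x + f < 0 then {A 1 *v x + e 1}
     else if c \<bullet> x + f = 0 then convex hull {A 1 *v x + e 1, A 2 *v x + e 2}
     else {A 2 *v x + e 2})"

definition abs_continuous_on_interval :: "real \<Rightarrow> real \<Rightarrow> (real \<Rightarrow> 'a::metric_space) \<Rightarrow> bool"
  where "abs_continuous_on_interval a b x \<longleftrightarrow>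
    (\<forall>\<epsilon>>0. \<exists>\<delta>>0. \<forall>(I :: nat set) s t.
       finite I \<longrightarrow>
       (\<forall>i\<in>I. a \<le> s i \<and> s i \<le> t i \<and> t i \<le> b) \<longrightarrow>
       disjoint_family_on (\<lambda>i. {s i<..<t i}) I \<longrightarrow>
       (\<Sum>i\<in>I. t i - s i) < \<delta> \<longrightarrow>
       (\<Sum>i\<in>I. dist (x (s i)) (x (t i))) < \<epsilon>)"

definition filippov_solution ::
  "(nat \<Rightarrow> real ^ 'n ^ 'n) \<Rightarrow> (nat \<Rightarrow> real ^ 'n) \<Rightarrow> real ^ 'n \<Rightarrow> real \<Rightarrow> real ^ 'n \<Rightarrow> (real \<Rightarrow> real ^ 'n) \<Rightarrow> bool"
  where "filippov_solution A e c f \<xi> x \<longleftrightarrow>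
    (\<forall>a b. abs_continuous_on_interval a b x) \<and>
    x 0 = \<xi> \<and>
    (AE t in lebesgue. \<exists>v \<in> filippov_map A e c f (x t). (x has_vector_derivative v) (at t))"

definition right_unique_solution ::
  "(nat \<Rightarrow> real ^ 'n ^ 'n) \<Rightarrow> (nat \<Rightarrow> real ^ 'n) \<Rightarrow> real ^ 'n \<Rightarrow> real \<Rightarrow> real ^ 'n \<Rightarrow> (real \<Rightarrow> real ^ 'n) \<Rightarrow> bool"
  where "right_unique_solution A e c f \<xi> x \<longleftrightarrow>
    (\<forall>x'. filippov_solution A e c f \<xi> x' \<longrightarrow> (\<exists>\<epsilon>>0. \<forall>t\<in>{0..<\<epsilon>}. x t = x' t))"

text \<open>
  The order on the numeral type \<open>3\<close> starts with \<open>3 = 0\<close>, so neither triangularity nor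
  the lexicographic order on \<open>real ^ 3\<close> can be expressed through the type's own order.
  The entries are therefore listed explicitly in the order 1, 2, 3.
\<close>

definition lex_pos :: "real list \<Rightarrow> bool"
  where "lex_pos v \<longleftrightarrow> (\<exists>i<length v. v ! i > 0 \<and> (\<forall>j<i. v ! j = 0))"

definition lex_greater :: "real ^ 3 \<Rightarrow> real ^ 3 \<Rightarrow> bool"  (infix \<open>\<succ>\<close> 50)
  where "v \<succ> w \<longleftrightarrow> lex_pos [(v - w) $ 1, (v - w) $ 2, (v - w) $ 3]"

definition lower_triangular :: "real ^ 3 ^ 3 \<Rightarrow> bool"
  where "lower_triangular M \<longleftrightarrow> M $ 1 $ 2 = 0 \<and> M $ 1 $ 3 = 0 \<and> M $ 2 $ 3 = 0"

text \<open>The row vector $v^T A$ is \<open>v v* A\<close>.\<close>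

definition linear_stack :: "real ^ 'n \<Rightarrow> real ^ 'n ^ 'n \<Rightarrow> real ^ 'n ^ 3"
  where "linear_stack c A = vector [c, c v* A, c v* (A ** A)]"

definition constant_stack :: "real ^ 'n \<Rightarrow> real \<Rightarrow> real ^ 'n ^ 'n \<Rightarrow> real ^ 'n \<Rightarrow> real ^ 3"
  where "constant_stack c f A e = vector [f, c \<bullet> e, (c v* A) \<bullet> e]"

definition exceptional_states ::
  "(nat \<Rightarrow> real ^ 'n ^ 'n) \<Rightarrow> (nat \<Rightarrow> real ^ 'n) \<Rightarrow> real ^ 'n \<Rightarrow> real \<Rightarrow> (real ^ 'n) set"
  where "exceptional_states A e c f =
    {\<xi>. \<exists>k\<in>{1, 2}. \<exists>j\<in>{1, 2}. k \<noteq> j \<and>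
       linear_stack c (A j) *v \<xi> + constant_stack c f (A j) (e j) = 0 \<and>
       (- 1) ^ k * ((c v* (A k ** A k)) \<bullet> \<xi> + (c v* A k) \<bullet> e k) < 0}"

end

theory Submission
  imports Defs
begin

text \<open>
  Write \<open>y = c \<bullet> x + f\<close>, let \<open>F\<close> and \<open>G\<close> be the affine fields of modes 1 and 2, and put
  \<open>z\<^sub>1 = c \<bullet> F\<close>, \<open>z\<^sub>2 = c \<bullet> G\<close>, and \<open>w\<^sub>1\<close>, \<open>w\<^sub>2\<close> for the derivatives of \<open>z\<^sub>1\<close>, \<open>z\<^sub>2\<close> along \<open>F\<close>, \<open>G\<close>. Let \<open>d\<close> be
  the difference of the two sides of the lexicographic inequality. Off the surface
  \<open>y = 0\<close> the solution follows one mode. On it the hypothesis gives \<open>z\<^sub>1 = m\<^sub>2\<^sub>2 z\<^sub>2 + d\<^sub>2\<close> with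
  \<open>m\<^sub>2\<^sub>2 > 0\<close> and \<open>d\<^sub>2 \<ge> 0\<close>, which leaves three possibilities: \<open>z\<^sub>1 > z\<^sub>2\<close>, where the Filippov field is
  one-sided Lipschitz in suitable coordinates; \<open>z\<^sub>1\<close> and \<open>z\<^sub>2\<close> of the same strict sign, where every
  solution enters the same mode; and \<open>z\<^sub>1 = z\<^sub>2 = 0\<close>. In the last case \<open>w\<^sub>1 = m\<^sub>3\<^sub>3 w\<^sub>2 + d\<^sub>3\<close> with
  \<open>d\<^sub>3 > 0\<close>, and outside the exceptional set neither \<open>w\<^sub>1\<close> nor \<open>w\<^sub>2\<close> vanishes. If they have the same
  sign, every solution again enters the same mode; if \<open>w\<^sub>1 > 0 > w\<^sub>2\<close>, an energy argument shows
  that \<open>y\<close> and \<open>z\<^sub>2\<close> stay 0, which determines the sliding motion.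
\<close>

section \<open>Absolutely continuous functions with bounded derivative\<close>

text \<open>
  On a fine tagged division the intervals tagged outside the exceptional null set contribute
  almost nonnegative increments, while the remaining ones lie in an open set of small measure
  and are controlled by absolute continuity.
\<close>

lemma abs_continuous_imp_mono:
  fixes g :: "real \<Rightarrow> real"
  assumes "a \<le> b" and ac: "abs_continuous_on_interval a b g"
    and deriv: "AE t in lebesgue. a < t \<longrightarrow> t < b \<longrightarrow> (\<exists>d\<ge>0. (g has_real_derivative d) (at t))"
  shows "g a \<le> g b"
proof (rule field_le_epsilon)
  fix \<eta> :: real assume "\<eta> > 0"
  \<comment> \<open>Error budget: slope error \<open>\<epsilon>\<close> over total length
    \<open>b - a\<close>, plus \<open>\<epsilon>\<close> for the intervals tagged in the null set,
    adds up to \<open>\<eta>\<close>. The extra 1 covers \<open>a = b\<close>.\<close>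
  define \<epsilon> where "\<epsilon> = \<eta> / (b - a + 1)"
  have \<epsilon>: "\<epsilon> > 0" "\<epsilon> * (b - a) + \<epsilon> = \<eta>"
  proof -
    have "b - a + 1 > 0" using \<open>a \<le> b\<close> by simp
    then show "\<epsilon> > 0" using \<open>\<eta> > 0\<close> by (simp add: \<epsilon>_def)
    have "\<epsilon> * (b - a) + \<epsilon> = \<epsilon> * (b - a + 1)" by (simp only: distrib_left mult_1_right)
    then show "\<epsilon> * (b - a) + \<epsilon> = \<eta>" using \<open>b - a + 1 > 0\<close> by (simp add: \<epsilon>_def)
  qed
  obtain \<delta> where "\<delta> > 0" and \<delta>: "\<And>(I :: nat set) s t. finite I \<Longrightarrow>
       (\<forall>i\<in>I. a \<le> s i \<and> s i \<le> t i \<and> t i \<le> b) \<Longrightarrow>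
       disjoint_family_on (\<lambda>i. {s i<..<t i}) I \<Longrightarrow>
       (\<Sum>i\<in>I. t i - s i) < \<delta> \<Longrightarrow>
       (\<Sum>i\<in>I. dist (g (s i)) (g (t i))) < \<epsilon>"
    using ac \<epsilon>(1) unfolding abs_continuous_on_interval_def by meson
  obtain N0 where "\<And>t. t \<in> space lebesgue - N0 \<Longrightarrow> a < t \<longrightarrow> t < b \<longrightarrow> (\<exists>d\<ge>0. (g has_real_derivative d) (at t))"
    and "N0 \<in> null_sets lebesgue"
    using AE_E3[OF deriv] by blast
  then have N0: "N0 \<in> null_sets lebesgue"
    "\<And>t. t \<notin> N0 \<Longrightarrow> a < t \<Longrightarrow> t < b \<Longrightarrow> \<exists>d\<ge>0. (g has_real_derivative d) (at t)"
    by auto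
  \<comment> \<open>The endpoints join the exceptional set because the derivative hypothesis speaks
    only of points strictly between \<open>a\<close> and \<open>b\<close>.\<close>
  define N where "N = N0 \<union> {a, b}"
  have "negligible N"
    using N0(1) by (auto simp: N_def negligible_iff_null_sets[symmetric])
  then have N: "N \<in> null_sets lebesgue"
    by (simp add: negligible_iff_null_sets)
  obtain U where U: "open U" "N \<subseteq> U" "U - N \<in> lmeasurable" "emeasure lebesgue (U - N) < ennreal \<delta>"
    using sets_lebesgue_outer_open[of N \<delta>] N \<open>\<delta> > 0\<close> by blast
  have emU: "emeasure lebesgue U < ennreal \<delta>"
    using U N by (metis borel_open emeasure_Diff_null_set sets_completionI_sets sets_lborel)
  have Um: "U \<in> lmeasurable"
    using emU U(1) by (intro fmeasurableI) (auto simp: top.not_eq_extremum intro: less_trans)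
  have mU: "measure lebesgue U < \<delta>"
    using emU Um \<open>\<delta> > 0\<close> by (simp add: emeasure_eq_measure2 ennreal_less_iff)
  \<comment> \<open>Radius of the gauge at \<open>t\<close>. For good \<open>t\<close>,
    differentiability gives an increment bound on every small interval that straddles
    \<open>t\<close>: the linearization errors on its two sides are proportional to the lengths of
    those sides, so they add up to \<open>\<epsilon> * (v - u)\<close>.\<close>
  have "\<exists>r>0. (t \<in> N \<longrightarrow> ball t r \<subseteq> U) \<and>
      (t \<notin> N \<longrightarrow> a < t \<longrightarrow> t < b \<longrightarrow> (\<forall>u v. u \<in> ball t r \<longrightarrow> v \<in> ball t r \<longrightarrow> u \<le> t \<longrightarrow> t \<le> v \<longrightarrow>
         g v - g u \<ge> - \<epsilon> * (v - u)))" for t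
  proof (cases "t \<in> N")
    case True
    then show ?thesis using U(1,2) open_contains_ball by blast
  next
    case False
    show ?thesis
    proof (cases "a < t \<and> t < b")
      case True
      with False N0(2)[of t] obtain d where d: "d \<ge> 0" "(g has_real_derivative d) (at t)"
        by (auto simp: N_def)
      then have "(g has_derivative (\<lambda>h. d * h)) (at t)"
        by (simp add: has_field_derivative_def)
      then obtain r where r: "r > 0" "\<And>y. norm (y - t) < r \<Longrightarrow> norm (g y - g t - d * (y - t)) \<le> \<epsilon> * norm (y - t)"
        using \<epsilon>(1) unfolding has_derivative_at_alt by meson
      have "g v - g u \<ge> - \<epsilon> * (v - u)" if "u \<in> ball t r" "v \<in> ball t r" "u \<le> t" "t \<le> v" for u v
      proof -
        have "\<bar>g v - g t - d * (v - t)\<bar> \<le> \<epsilon> * (v - t)" "\<bar>g u - g t - d * (u - t)\<bar> \<le> \<epsilon> * (t - u)"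
          using r(2)[of v] r(2)[of u] that by (auto simp: dist_real_def abs_minus_commute)
        moreover have "d * (v - t) \<ge> 0" "d * (u - t) \<le> 0"
          using d that by (auto intro: mult_nonneg_nonpos)
        ultimately have "g v - g u \<ge> - (\<epsilon> * (v - t)) - (\<epsilon> * (t - u))" by linarith
        then show ?thesis by (simp add: algebra_simps)
      qed
      then show ?thesis using r(1) False by blast
    qed (use False in \<open>auto intro: exI[of _ 1]\<close>)
  qed
  then obtain r where r: "\<And>t. r t > 0" "\<And>t. t \<in> N \<Longrightarrow> ball t (r t) \<subseteq> U"
    "\<And>t u v. t \<notin> N \<Longrightarrow> a < t \<Longrightarrow> t < b \<Longrightarrow> u \<in> ball t (r t) \<Longrightarrow> v \<in> ball t (r t) \<Longrightarrow> u \<le> t \<Longrightarrow> t \<le> v \<Longrightarrow>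
         g v - g u \<ge> - \<epsilon> * (v - u)"
    by metis
  have "gauge (\<lambda>t. ball t (r t))" using r(1) by (simp add: gauge_ball_dependent)
  then obtain p where p: "p tagged_division_of {a..b}" "(\<lambda>t. ball t (r t)) fine p"
    using fine_division_exists_real by blast
  have finp: "finite p" using p(1) by blast
  define lo hi where "lo = (\<lambda>q :: real \<times> real set. Inf (snd q))" and "hi = (\<lambda>q :: real \<times> real set. Sup (snd q))"
  have q: "snd q = {lo q..hi q} \<and> lo q \<le> fst q \<and> fst q \<le> hi q \<and> a \<le> lo q \<and> hi q \<le> b
      \<and> {lo q..hi q} \<subseteq> ball (fst q) (r (fst q))" if "q \<in> p" for q
  proof -
    obtain t K where q: "q = (t, K)" by force
    have K: "t \<in> K" "K \<subseteq> {a..b}" "\<exists>u v. K = cbox u v" "K \<subseteq> ball t (r t)"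
      using p that tagged_division_ofD(2-4)[OF p(1)] fineD[OF p(2)] unfolding q by blast+
    then obtain u v where uv: "K = {u..v}" by auto
    with K have "u \<le> v" by auto
    with uv K show ?thesis by (auto simp: q lo_def hi_def)
  qed
  have sum_eq: "(\<Sum>q\<in>p. g (hi q) - g (lo q)) = g b - g a" for g :: "real \<Rightarrow> real"
    using additive_tagged_division_1[OF \<open>a \<le> b\<close> p(1), of g]
    by (simp add: lo_def hi_def case_prod_unfold)
  define P where "P = {q \<in> p. fst q \<in> N}"
  have "P \<subseteq> p" and finP: "finite P" using finp by (auto simp: P_def)
  have disj: "disjoint_family_on (\<lambda>q. {lo q<..<hi q}) p"
    unfolding disjoint_family_on_def
  proof (intro ballI impI)
    fix m n assume mn: "m \<in> p" "n \<in> p" "m \<noteq> n"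
    then have "interior (snd m) \<inter> interior (snd n) = {}"
      using tagged_division_ofD(5)[OF p(1), of "fst m" "snd m" "fst n" "snd n"] by (auto simp: prod_eq_iff)
    then show "{lo m<..<hi m} \<inter> {lo n<..<hi n} = {}"
      using q[OF mn(1)] q[OF mn(2)] by (metis interior_atLeastAtMost_real)
  qed
  have disjP: "disjoint_family_on (\<lambda>q. {lo q<..<hi q}) P"
    using disj \<open>P \<subseteq> p\<close> by (rule disjoint_family_on_mono[rotated])
  have "(\<Sum>q\<in>P. hi q - lo q) = (\<Sum>q\<in>P. measure lebesgue {lo q<..<hi q})"
    using q \<open>P \<subseteq> p\<close> by (intro sum.cong) (force simp: measure_completion)+
  also have "\<dots> = measure lebesgue (\<Union>q\<in>P. {lo q<..<hi q})"
  proof (intro measure_finite_Union[symmetric] finP disjP)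
    show "emeasure lebesgue {lo q<..<hi q} \<noteq> \<infinity>" for q by (cases "lo q \<le> hi q") auto
  qed auto
  also have "\<dots> \<le> measure lebesgue U"
  proof (rule measure_mono_fmeasurable)
    show "(\<Union>q\<in>P. {lo q<..<hi q}) \<subseteq> U"
      using q r(2) \<open>P \<subseteq> p\<close> by (force simp: P_def)
  qed (use Um finP in auto)
  finally have lenP: "(\<Sum>q\<in>P. hi q - lo q) < \<delta>" using mU by simp
  \<comment> \<open>\<open>abs_continuous_on_interval\<close> indexes its intervals by natural
    numbers, so the members of \<open>P\<close> are enumerated before it is applied.\<close>
  obtain h where h: "bij_betw h {0..<card P} P"
    using finP ex_bij_betw_nat_finite by blast
  have "(\<Sum>i\<in>{0..<card P}. dist (g (lo (h i))) (g (hi (h i)))) < \<epsilon>"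
  proof (rule \<delta>)
    show "\<forall>i\<in>{0..<card P}. a \<le> lo (h i) \<and> lo (h i) \<le> hi (h i) \<and> hi (h i) \<le> b"
    proof
      fix i assume "i \<in> {0..<card P}"
      then have "h i \<in> p" using bij_betwE[OF h] \<open>P \<subseteq> p\<close> by blast
      from q[OF this] show "a \<le> lo (h i) \<and> lo (h i) \<le> hi (h i) \<and> hi (h i) \<le> b" by linarith
    qed
    show "disjoint_family_on (\<lambda>i. {lo (h i)<..<hi (h i)}) {0..<card P}"
      using disjP bij_betwE[OF h] bij_betw_imp_inj_on[OF h]
      unfolding disjoint_family_on_def inj_on_def by metis
    show "(\<Sum>i = 0..<card P. hi (h i) - lo (h i)) < \<delta>"
      using lenP sum.reindex_bij_betw[OF h, of "\<lambda>q. hi q - lo q"] by simp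
  qed simp
  then have "(\<Sum>q\<in>P. dist (g (lo q)) (g (hi q))) < \<epsilon>"
    using sum.reindex_bij_betw[OF h, of "\<lambda>q. dist (g (lo q)) (g (hi q))"] by simp
  moreover have "(\<Sum>q\<in>P. g (hi q) - g (lo q)) \<ge> (\<Sum>q\<in>P. - dist (g (lo q)) (g (hi q)))"
    by (intro sum_mono) (auto simp: dist_real_def)
  ultimately have 1: "(\<Sum>q\<in>P. g (hi q) - g (lo q)) \<ge> - \<epsilon>"
    by (simp add: sum_negf)
  have "(\<Sum>q\<in>p - P. g (hi q) - g (lo q)) \<ge> (\<Sum>q\<in>p - P. - \<epsilon> * (hi q - lo q))"
  proof (rule sum_mono)
    fix t assume t: "t \<in> p - P"
    then have n: "fst t \<notin> N" by (auto simp: P_def)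
    with q[of t] t have "a < fst t" "fst t < b" by (auto simp: N_def less_le)
    then show "- \<epsilon> * (hi t - lo t) \<le> g (hi t) - g (lo t)"
      using q[of t] t n by (intro r(3)[of "fst t"]) (auto simp: subset_eq simp del: mem_ball)
  qed
  \<comment> \<open>Restoring the intervals of \<open>P\<close> only lowers the bound, and over all
    of \<open>p\<close> the lengths telescope to \<open>b - a\<close>.\<close>
  moreover have "(\<Sum>q\<in>p - P. - \<epsilon> * (hi q - lo q)) \<ge> (\<Sum>q\<in>p. - \<epsilon> * (hi q - lo q))"
  proof -
    have "(\<Sum>q\<in>p - P. hi q - lo q) \<le> (\<Sum>q\<in>p. hi q - lo q)"
    proof (rule sum_mono2[OF finp])
      show "0 \<le> hi t - lo t" if "t \<in> p - (p - P)" for t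
        using q[of t] that by simp
    qed auto
    then show ?thesis unfolding sum_distrib_left[symmetric] using \<epsilon>(1) by simp
  qed
  moreover have "(\<Sum>q\<in>p. - \<epsilon> * (hi q - lo q)) = - \<epsilon> * (b - a)"
    unfolding sum_distrib_left[symmetric] using sum_eq[of "\<lambda>t. t"] by simp
  ultimately have 2: "(\<Sum>q\<in>p - P. g (hi q) - g (lo q)) \<ge> - \<epsilon> * (b - a)" by linarith
  have "g b - g a = (\<Sum>q\<in>p - P. g (hi q) - g (lo q)) + (\<Sum>q\<in>P. g (hi q) - g (lo q))"
    using sum.subset_diff[OF \<open>P \<subseteq> p\<close> finp, of "\<lambda>q. g (hi q) - g (lo q)"] sum_eq[of g] by simp
  with 1 2 \<epsilon>(2) show "g a \<le> g b + \<eta>" by simp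
qed

section \<open>Closure properties of absolute continuity\<close>

lemma abs_continuous_on_interval_mono:
  assumes "abs_continuous_on_interval a b x" "a \<le> a'" "b' \<le> b"
  shows "abs_continuous_on_interval a' b' x"
  unfolding abs_continuous_on_interval_def
proof (intro allI impI)
  fix \<epsilon> :: real assume "\<epsilon> > 0"
  then obtain \<delta> where "\<delta> > 0" and \<delta>: "\<And>(I :: nat set) s t. finite I \<Longrightarrow>
       (\<forall>i\<in>I. a \<le> s i \<and> s i \<le> t i \<and> t i \<le> b) \<Longrightarrow> disjoint_family_on (\<lambda>i. {s i<..<t i}) I \<Longrightarrow>
       (\<Sum>i\<in>I. t i - s i) < \<delta> \<Longrightarrow> (\<Sum>i\<in>I. dist (x (s i)) (x (t i))) < \<epsilon>"
    using assms(1) unfolding abs_continuous_on_interval_def by meson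
  show "\<exists>\<delta>>0. \<forall>(I :: nat set) s t. finite I \<longrightarrow> (\<forall>i\<in>I. a' \<le> s i \<and> s i \<le> t i \<and> t i \<le> b') \<longrightarrow>
      disjoint_family_on (\<lambda>i. {s i<..<t i}) I \<longrightarrow> (\<Sum>i\<in>I. t i - s i) < \<delta> \<longrightarrow>
      (\<Sum>i\<in>I. dist (x (s i)) (x (t i))) < \<epsilon>"
    using \<open>\<delta> > 0\<close> assms(2,3) by (intro exI[of _ \<delta>] conjI allI impI \<delta>) force+
qed

lemma abs_continuous_on_interval_lipschitz:
  assumes "L-lipschitz_on {a..b} g"
  shows "abs_continuous_on_interval a b g"
  unfolding abs_continuous_on_interval_def
proof (intro allI impI)
  fix \<epsilon> :: real assume "\<epsilon> > 0"
  have "L \<ge> 0" using assms by (rule lipschitz_on_nonneg)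
  show "\<exists>\<delta>>0. \<forall>(I :: nat set) s t. finite I \<longrightarrow> (\<forall>i\<in>I. a \<le> s i \<and> s i \<le> t i \<and> t i \<le> b) \<longrightarrow>
      disjoint_family_on (\<lambda>i. {s i<..<t i}) I \<longrightarrow> (\<Sum>i\<in>I. t i - s i) < \<delta> \<longrightarrow>
      (\<Sum>i\<in>I. dist (g (s i)) (g (t i))) < \<epsilon>"
  proof (intro exI conjI allI impI)
    \<comment> \<open>Dividing by \<open>L + 1\<close> instead of \<open>L\<close> keeps
      \<open>\<delta>\<close> well defined when \<open>L = 0\<close>.\<close>
    show "\<epsilon> / (L + 1) > 0" using \<open>\<epsilon> > 0\<close> \<open>L \<ge> 0\<close> by simp
    fix I :: "nat set" and s t
    assume I: "finite I" "\<forall>i\<in>I. a \<le> s i \<and> s i \<le> t i \<and> t i \<le> b" "(\<Sum>i\<in>I. t i - s i) < \<epsilon> / (L + 1)"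
    have "(\<Sum>i\<in>I. dist (g (s i)) (g (t i))) \<le> (\<Sum>i\<in>I. (L + 1) * (t i - s i))"
    proof (rule sum_mono)
      fix i assume "i \<in> I"
      with I have "a \<le> s i" "s i \<le> t i" "t i \<le> b" by auto
      then have "dist (g (s i)) (g (t i)) \<le> L * (t i - s i)"
        using lipschitz_onD[OF assms, of "s i" "t i"] by (auto simp: dist_real_def)
      then show "dist (g (s i)) (g (t i)) \<le> (L + 1) * (t i - s i)"
        using \<open>s i \<le> t i\<close> by (simp add: algebra_simps)
    qed
    also have "\<dots> = (L + 1) * (\<Sum>i\<in>I. t i - s i)" by (simp only: sum_distrib_left)
    also have "\<dots> < \<epsilon>"
      using I(3) \<open>L \<ge> 0\<close> by (simp add: pos_less_divide_eq mult.commute)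
    finally show "(\<Sum>i\<in>I. dist (g (s i)) (g (t i))) < \<epsilon>" .
  qed
qed

lemma abs_continuous_on_interval_compose_lipschitz:
  assumes x: "abs_continuous_on_interval a b x" and g: "L-lipschitz_on UNIV g"
  shows "abs_continuous_on_interval a b (\<lambda>t. g (x t))"
  unfolding abs_continuous_on_interval_def
proof (intro allI impI)
  fix \<epsilon> :: real assume "\<epsilon> > 0"
  have "L \<ge> 0" using g by (rule lipschitz_on_nonneg)
  then have "\<epsilon> / (L + 1) > 0" using \<open>\<epsilon> > 0\<close> by simp
  then obtain \<delta> where "\<delta> > 0" and \<delta>: "\<And>(I :: nat set) s t. finite I \<Longrightarrow>
       (\<forall>i\<in>I. a \<le> s i \<and> s i \<le> t i \<and> t i \<le> b) \<Longrightarrow> disjoint_family_on (\<lambda>i. {s i<..<t i}) I \<Longrightarrow>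
       (\<Sum>i\<in>I. t i - s i) < \<delta> \<Longrightarrow> (\<Sum>i\<in>I. dist (x (s i)) (x (t i))) < \<epsilon> / (L + 1)"
    using x unfolding abs_continuous_on_interval_def by meson
  show "\<exists>\<delta>>0. \<forall>(I :: nat set) s t. finite I \<longrightarrow> (\<forall>i\<in>I. a \<le> s i \<and> s i \<le> t i \<and> t i \<le> b) \<longrightarrow>
      disjoint_family_on (\<lambda>i. {s i<..<t i}) I \<longrightarrow> (\<Sum>i\<in>I. t i - s i) < \<delta> \<longrightarrow>
      (\<Sum>i\<in>I. dist (g (x (s i))) (g (x (t i)))) < \<epsilon>"
  proof (intro exI[of _ \<delta>] conjI allI impI)
    fix I :: "nat set" and s t
    assume I: "finite I" "\<forall>i\<in>I. a \<le> s i \<and> s i \<le> t i \<and> t i \<le> b"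
      "disjoint_family_on (\<lambda>i. {s i<..<t i}) I" "(\<Sum>i\<in>I. t i - s i) < \<delta>"
    have "(\<Sum>i\<in>I. dist (g (x (s i))) (g (x (t i)))) \<le> (\<Sum>i\<in>I. (L + 1) * dist (x (s i)) (x (t i)))"
    proof (rule sum_mono)
      fix i
      have "dist (g (x (s i))) (g (x (t i))) \<le> L * dist (x (s i)) (x (t i))"
        using lipschitz_onD[OF g] by auto
      then show "dist (g (x (s i))) (g (x (t i))) \<le> (L + 1) * dist (x (s i)) (x (t i))"
        by (simp add: algebra_simps add_increasing)
    qed
    also have "\<dots> = (L + 1) * (\<Sum>i\<in>I. dist (x (s i)) (x (t i)))" by (simp only: sum_distrib_left)
    also have "\<dots> < \<epsilon>"
      using \<delta>[OF I] \<open>L \<ge> 0\<close> by (simp add: pos_less_divide_eq mult.commute)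
    finally show "(\<Sum>i\<in>I. dist (g (x (s i))) (g (x (t i)))) < \<epsilon>" .
  qed fact
qed

lemma abs_continuous_on_interval_add:
  fixes g h :: "real \<Rightarrow> 'a::real_normed_vector"
  assumes g: "abs_continuous_on_interval a b g" and h: "abs_continuous_on_interval a b h"
  shows "abs_continuous_on_interval a b (\<lambda>t. g t + h t)"
  unfolding abs_continuous_on_interval_def
proof (intro allI impI)
  fix \<epsilon> :: real assume "\<epsilon> > 0"
  then have e2: "\<epsilon> / 2 > 0" by simp
  obtain \<delta>1 where "\<delta>1 > 0" and \<delta>1: "\<And>(I :: nat set) s t. finite I \<Longrightarrow>
       (\<forall>i\<in>I. a \<le> s i \<and> s i \<le> t i \<and> t i \<le> b) \<Longrightarrow> disjoint_family_on (\<lambda>i. {s i<..<t i}) I \<Longrightarrow>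
       (\<Sum>i\<in>I. t i - s i) < \<delta>1 \<Longrightarrow> (\<Sum>i\<in>I. dist (g (s i)) (g (t i))) < \<epsilon> / 2"
    using g e2 unfolding abs_continuous_on_interval_def by meson
  obtain \<delta>2 where "\<delta>2 > 0" and \<delta>2: "\<And>(I :: nat set) s t. finite I \<Longrightarrow>
       (\<forall>i\<in>I. a \<le> s i \<and> s i \<le> t i \<and> t i \<le> b) \<Longrightarrow> disjoint_family_on (\<lambda>i. {s i<..<t i}) I \<Longrightarrow>
       (\<Sum>i\<in>I. t i - s i) < \<delta>2 \<Longrightarrow> (\<Sum>i\<in>I. dist (h (s i)) (h (t i))) < \<epsilon> / 2"
    using h e2 unfolding abs_continuous_on_interval_def by meson
  show "\<exists>\<delta>>0. \<forall>(I :: nat set) s t. finite I \<longrightarrow> (\<forall>i\<in>I. a \<le> s i \<and> s i \<le> t i \<and> t i \<le> b) \<longrightarrow>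
      disjoint_family_on (\<lambda>i. {s i<..<t i}) I \<longrightarrow> (\<Sum>i\<in>I. t i - s i) < \<delta> \<longrightarrow>
      (\<Sum>i\<in>I. dist (g (s i) + h (s i)) (g (t i) + h (t i))) < \<epsilon>"
  proof (intro exI[of _ "min \<delta>1 \<delta>2"] conjI allI impI)
    fix I :: "nat set" and s t
    assume I: "finite I" "\<forall>i\<in>I. a \<le> s i \<and> s i \<le> t i \<and> t i \<le> b"
      "disjoint_family_on (\<lambda>i. {s i<..<t i}) I" "(\<Sum>i\<in>I. t i - s i) < min \<delta>1 \<delta>2"
    have "(\<Sum>i\<in>I. dist (g (s i) + h (s i)) (g (t i) + h (t i))) \<le>
       (\<Sum>i\<in>I. dist (g (s i)) (g (t i)) + dist (h (s i)) (h (t i)))"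
      by (rule sum_mono) (rule dist_triangle_add)
    also have "\<dots> < \<epsilon>"
      using \<delta>1[OF I(1-3)] \<delta>2[OF I(1-3)] I(4) by (simp add: sum.distrib)
    finally show "(\<Sum>i\<in>I. dist (g (s i) + h (s i)) (g (t i) + h (t i))) < \<epsilon>" .
  qed (use \<open>\<delta>1 > 0\<close> \<open>\<delta>2 > 0\<close> in auto)
qed

lemma abs_continuous_on_interval_imp_continuous_on:
  assumes "abs_continuous_on_interval a b x"
  shows "continuous_on {a..b} x"
  unfolding continuous_on_iff
proof (intro ballI allI impI)
  fix t \<epsilon> :: real assume "t \<in> {a..b}" "\<epsilon> > 0"
  then obtain \<delta> where "\<delta> > 0" and \<delta>: "\<And>(I :: nat set) s t. finite I \<Longrightarrow>
       (\<forall>i\<in>I. a \<le> s i \<and> s i \<le> t i \<and> t i \<le> b) \<Longrightarrow> disjoint_family_on (\<lambda>i. {s i<..<t i}) I \<Longrightarrow>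
       (\<Sum>i\<in>I. t i - s i) < \<delta> \<Longrightarrow> (\<Sum>i\<in>I. dist (x (s i)) (x (t i))) < \<epsilon>"
    using assms unfolding abs_continuous_on_interval_def by meson
  \<comment> \<open>Continuity is absolute continuity for a family of one interval, the one spanned
    by \<open>u\<close> and \<open>t\<close>.\<close>
  have "dist (x u) (x t) < \<epsilon>" if "u \<in> {a..b}" "dist u t < \<delta>" for u
    using \<delta>[of "{0}" "\<lambda>_. min u t" "\<lambda>_. max u t"] that \<open>t \<in> {a..b}\<close>
    by (cases "u \<le> t") (auto simp: disjoint_family_on_def dist_real_def dist_commute)
  with \<open>\<delta> > 0\<close> show "\<exists>d>0. \<forall>u\<in>{a..b}. dist u t < d \<longrightarrow> dist (x u) (x t) < \<epsilon>" by blast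
qed

text \<open>Reduction to the scalar monotonicity lemma: for the unit vector \<open>w\<close>
  pointing from \<open>x s\<close> to \<open>x t\<close>, the function
  \<open>B * u - w \<bullet> x u\<close> has a nonnegative derivative almost everywhere by
  Cauchy-Schwarz, and its increment over \<open>{s..t}\<close> is \<open>B * (t - s)\<close> minus
  the distance from \<open>x s\<close> to \<open>x t\<close>.\<close>

lemma abs_continuous_bounded_derivative_imp_lipschitz:
  fixes x :: "real \<Rightarrow> 'a::euclidean_space"
  assumes ac: "abs_continuous_on_interval a b x" and "B \<ge> 0"
    and deriv: "AE t in lebesgue. a < t \<longrightarrow> t < b \<longrightarrow> (\<exists>v. (x has_vector_derivative v) (at t) \<and> norm v \<le> B)"
  shows "B-lipschitz_on {a..b} x"
proof (rule lipschitz_onI)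
  have *: "dist (x s) (x t) \<le> B * dist s t" if st: "a \<le> s" "s \<le> t" "t \<le> b" for s t
  proof (cases "x t = x s")
    case True
    then show ?thesis using \<open>B \<ge> 0\<close> by simp
  next
    case False
    define w where "w = sgn (x t - x s)"
    have w: "norm w = 1" using False by (simp add: w_def norm_sgn)
    have "1-lipschitz_on UNIV (\<lambda>z. - (w \<bullet> z))"
    proof (rule lipschitz_onI)
      fix y z
      have "dist (- (w \<bullet> y)) (- (w \<bullet> z)) = \<bar>w \<bullet> (y - z)\<bar>"
        by (simp add: dist_real_def inner_diff_right)
      then show "dist (- (w \<bullet> y)) (- (w \<bullet> z)) \<le> 1 * dist y z"
        using Cauchy_Schwarz_ineq2[of w "y - z"] w by (simp add: dist_norm)
    qed simp
    from abs_continuous_on_interval_compose_lipschitz[OF abs_continuous_on_interval_mono[OF ac st(1,3)] this]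
    have acw: "abs_continuous_on_interval s t (\<lambda>u. - (w \<bullet> x u))" .
    have l: "(B + 1)-lipschitz_on {s..t} (\<lambda>u. B * u)"
      using \<open>B \<ge> 0\<close> by (intro lipschitz_onI) (auto simp: dist_real_def abs_mult right_diff_distrib[symmetric] mult_right_mono)
    let ?g = "\<lambda>u. B * u - w \<bullet> x u"
    have "abs_continuous_on_interval s t ?g"
      using abs_continuous_on_interval_add[OF abs_continuous_on_interval_lipschitz[OF l] acw] by simp
    moreover have "AE u in lebesgue. s < u \<longrightarrow> u < t \<longrightarrow> (\<exists>d\<ge>0. (?g has_real_derivative d) (at u))"
      using deriv
    proof eventually_elim
      case (elim u)
      show ?case
      proof (intro impI)
        assume "s < u" "u < t"
        with elim st obtain v where v: "(x has_vector_derivative v) (at u)" "norm v \<le> B" by auto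
        have "(?g has_vector_derivative (B - w \<bullet> v)) (at u)"
          by (rule derivative_eq_intros bounded_linear.has_vector_derivative[OF bounded_linear_inner_right] v(1) | simp)+
        moreover have "w \<bullet> v \<le> B"
          using norm_cauchy_schwarz[of w v] w v(2) by simp
        ultimately show "\<exists>d\<ge>0. (?g has_real_derivative d) (at u)"
          by (intro exI[of _ "B - w \<bullet> v"]) (simp add: has_real_derivative_iff_has_vector_derivative)
      qed
    qed
    ultimately have "?g s \<le> ?g t"
      by (rule abs_continuous_imp_mono[OF st(2)])
    then have "w \<bullet> (x t - x s) \<le> B * (t - s)"
      unfolding inner_diff_right right_diff_distrib by linarith
    moreover have "w \<bullet> (x t - x s) = norm (x t - x s)"
      using False by (simp add: w_def sgn_div_norm power2_norm_eq_inner[symmetric] power2_eq_square)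
    ultimately show ?thesis using st by (simp add: dist_norm norm_minus_commute)
  qed
  fix s t assume "s \<in> {a..b}" "t \<in> {a..b}"
  then show "dist (x s) (x t) \<le> B * dist s t"
    using *[of s t] *[of t s] by (cases "s \<le> t") (auto simp: dist_commute)
qed (fact \<open>B \<ge> 0\<close>)

section \<open>Bounded Lipschitz functions and Gronwall estimates\<close>

text \<open>Boundedness is part of the notion because it makes the class closed under products, so
  that regularity of composite expressions follows from introduction rules. One constant
  \<open>M\<close> serves both bounds.\<close>

definition bounded_lipschitz_on :: "'a::metric_space set \<Rightarrow> ('a \<Rightarrow> 'b::real_normed_vector) \<Rightarrow> bool"
  where "bounded_lipschitz_on S g \<longleftrightarrow>
    (\<exists>M\<ge>0. (\<forall>x\<in>S. norm (g x) \<le> M) \<and> (\<forall>x\<in>S. \<forall>y\<in>S. norm (g x - g y) \<le> M * dist x y))"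

lemma bounded_lipschitz_onI:
  assumes "\<And>x. x \<in> S \<Longrightarrow> norm (g x) \<le> B"
    and "\<And>x y. x \<in> S \<Longrightarrow> y \<in> S \<Longrightarrow> norm (g x - g y) \<le> L * dist x y"
  shows "bounded_lipschitz_on S g"
  unfolding bounded_lipschitz_on_def
proof (intro exI[of _ "max 0 (max B L)"] conjI ballI)
  fix x y assume xy: "x \<in> S" "y \<in> S"
  show "norm (g x) \<le> max 0 (max B L)" using assms(1)[OF xy(1)] by simp
  have "norm (g x - g y) \<le> L * dist x y" using assms(2) xy .
  also have "\<dots> \<le> max 0 (max B L) * dist x y" by (intro mult_right_mono) auto
  finally show "norm (g x - g y) \<le> max 0 (max B L) * dist x y" .
qed simp

lemma bounded_lipschitz_onE:
  assumes "bounded_lipschitz_on S g"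
  obtains M where "M \<ge> 0" "\<And>x. x \<in> S \<Longrightarrow> norm (g x) \<le> M"
    "\<And>x y. x \<in> S \<Longrightarrow> y \<in> S \<Longrightarrow> norm (g x - g y) \<le> M * dist x y"
  using assms unfolding bounded_lipschitz_on_def by blast

lemma bounded_lipschitz_on_subset:
  "bounded_lipschitz_on S g \<Longrightarrow> S' \<subseteq> S \<Longrightarrow> bounded_lipschitz_on S' g"
  unfolding bounded_lipschitz_on_def by (meson subsetD)

lemma bounded_lipschitz_on_const: "bounded_lipschitz_on S (\<lambda>x. k)"
  by (rule bounded_lipschitz_onI[of _ _ "norm k" 0]) auto

lemma bounded_lipschitz_on_id:
  fixes S :: "'a::real_normed_vector set"
  assumes "bounded S"
  shows "bounded_lipschitz_on S (\<lambda>x. x)"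
proof -
  obtain B where "\<And>x. x \<in> S \<Longrightarrow> norm x \<le> B" using assms by (auto simp: bounded_iff)
  then show ?thesis by (rule bounded_lipschitz_onI[of _ _ _ 1]) (auto simp: dist_norm)
qed

lemma bounded_lipschitz_on_add:
  assumes "bounded_lipschitz_on S g" "bounded_lipschitz_on S h"
  shows "bounded_lipschitz_on S (\<lambda>x. g x + h x)"
proof -
  obtain M where M: "\<And>x. x \<in> S \<Longrightarrow> norm (g x) \<le> M"
    "\<And>x y. x \<in> S \<Longrightarrow> y \<in> S \<Longrightarrow> norm (g x - g y) \<le> M * dist x y"
    using bounded_lipschitz_onE[OF assms(1)] by metis
  obtain N where N: "\<And>x. x \<in> S \<Longrightarrow> norm (h x) \<le> N"
    "\<And>x y. x \<in> S \<Longrightarrow> y \<in> S \<Longrightarrow> norm (h x - h y) \<le> N * dist x y"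
    using bounded_lipschitz_onE[OF assms(2)] by metis
  show ?thesis
  proof (rule bounded_lipschitz_onI)
    fix x y assume xy: "x \<in> S" "y \<in> S"
    show "norm (g x + h x) \<le> M + N" using norm_triangle_mono[OF M(1) N(1)] xy by blast
    have "norm ((g x - g y) + (h x - h y)) \<le> M * dist x y + N * dist x y"
      using norm_triangle_mono[OF M(2) N(2)] xy by blast
    then show "norm (g x + h x - (g y + h y)) \<le> (M + N) * dist x y"
      by (simp add: algebra_simps)
  qed
qed

text \<open>The usual splitting of a product difference, changing one factor at a time; stated for
  bilinear maps so as to cover multiplication, scaling and inner products at once.\<close>

lemma bounded_lipschitz_on_bilinear:
  assumes "bounded_bilinear pr" and "bounded_lipschitz_on S g" "bounded_lipschitz_on S h"
  shows "bounded_lipschitz_on S (\<lambda>x. pr (g x) (h x))"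
proof -
  interpret bounded_bilinear pr by fact
  obtain M where M: "M \<ge> 0" "\<And>x. x \<in> S \<Longrightarrow> norm (g x) \<le> M"
    "\<And>x y. x \<in> S \<Longrightarrow> y \<in> S \<Longrightarrow> norm (g x - g y) \<le> M * dist x y"
    using bounded_lipschitz_onE[OF assms(2)] by metis
  obtain N where N: "N \<ge> 0" "\<And>x. x \<in> S \<Longrightarrow> norm (h x) \<le> N"
    "\<And>x y. x \<in> S \<Longrightarrow> y \<in> S \<Longrightarrow> norm (h x - h y) \<le> N * dist x y"
    using bounded_lipschitz_onE[OF assms(3)] by metis
  obtain K where K: "K \<ge> 0" "\<And>a b. norm (pr a b) \<le> norm a * norm b * K"
    using nonneg_bounded by blast
  show ?thesis
  proof (rule bounded_lipschitz_onI)
    fix x y assume xy: "x \<in> S" "y \<in> S"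
    have "norm (g x) * norm (h x) * K \<le> M * N * K"
      using M N K xy by (intro mult_right_mono mult_mono) auto
    then show "norm (pr (g x) (h x)) \<le> M * N * K" using K(2) order_trans by blast
    have "pr (g x) (h x) - pr (g y) (h y) = pr (g x - g y) (h x) + pr (g y) (h x - h y)"
      by (simp add: diff_left diff_right)
    also have "norm \<dots> \<le> norm (g x - g y) * norm (h x) * K + norm (g y) * norm (h x - h y) * K"
      by (rule norm_triangle_mono) (rule K(2))+
    also have "\<dots> \<le> (M * dist x y) * N * K + M * (N * dist x y) * K"
      using M N K xy by (intro add_mono mult_right_mono mult_mono) auto
    finally show "norm (pr (g x) (h x) - pr (g y) (h y)) \<le> (2 * M * N * K) * dist x y"
      by (simp add: algebra_simps)
  qed
qed

lemmas bounded_lipschitz_on_mult =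
  bounded_lipschitz_on_bilinear[OF bounded_bilinear_mult]
lemmas bounded_lipschitz_on_scaleR =
  bounded_lipschitz_on_bilinear[OF bounded_bilinear_scaleR]
lemmas bounded_lipschitz_on_inner =
  bounded_lipschitz_on_bilinear[OF bounded_bilinear_inner]

lemma bounded_lipschitz_on_linear:
  assumes "bounded_linear B" "bounded_lipschitz_on S g"
  shows "bounded_lipschitz_on S (\<lambda>x. B (g x))"
proof -
  interpret bounded_linear B by fact
  obtain M where M: "\<And>x. x \<in> S \<Longrightarrow> norm (g x) \<le> M"
    "\<And>x y. x \<in> S \<Longrightarrow> y \<in> S \<Longrightarrow> norm (g x - g y) \<le> M * dist x y"
    using bounded_lipschitz_onE[OF assms(2)] by metis
  obtain K where K: "K \<ge> 0" "\<And>a. norm (B a) \<le> norm a * K" using nonneg_bounded by blast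
  show ?thesis
  proof (rule bounded_lipschitz_onI)
    fix x y assume xy: "x \<in> S" "y \<in> S"
    show "norm (B (g x)) \<le> M * K" using K M(1)[OF xy(1)] by (meson mult_right_mono order_trans)
    have "norm (B (g x - g y)) \<le> M * dist x y * K"
      using K M(2)[OF xy] by (meson mult_right_mono order_trans)
    then show "norm (B (g x) - B (g y)) \<le> (M * K) * dist x y" by (simp add: diff algebra_simps)
  qed
qed

lemma bounded_lipschitz_on_minus:
  "bounded_lipschitz_on S g \<Longrightarrow> bounded_lipschitz_on S (\<lambda>x. - g x)"
  by (rule bounded_lipschitz_on_linear[OF bounded_linear_minus[OF bounded_linear_ident]])

lemma bounded_lipschitz_on_diff:
  "bounded_lipschitz_on S g \<Longrightarrow> bounded_lipschitz_on S h \<Longrightarrow> bounded_lipschitz_on S (\<lambda>x. g x - h x)"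
  using bounded_lipschitz_on_add[OF _ bounded_lipschitz_on_minus] by fastforce

lemma bounded_lipschitz_on_compose:
  assumes g: "bounded_lipschitz_on S g" and h: "bounded_lipschitz_on R h" and "h ` R \<subseteq> S"
  shows "bounded_lipschitz_on R (\<lambda>x. g (h x))"
proof -
  obtain M where M: "M \<ge> 0" "\<And>x. x \<in> S \<Longrightarrow> norm (g x) \<le> M"
    "\<And>x y. x \<in> S \<Longrightarrow> y \<in> S \<Longrightarrow> norm (g x - g y) \<le> M * dist x y"
    using bounded_lipschitz_onE[OF g] by metis
  obtain N where N: "\<And>x y. x \<in> R \<Longrightarrow> y \<in> R \<Longrightarrow> norm (h x - h y) \<le> N * dist x y"
    using bounded_lipschitz_onE[OF h] by metis
  show ?thesis
  proof (rule bounded_lipschitz_onI)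
    fix x y assume xy: "x \<in> R" "y \<in> R"
    then have S: "h x \<in> S" "h y \<in> S" using assms(3) by auto
    show "norm (g (h x)) \<le> M" using M S by simp
    have "norm (g (h x) - g (h y)) \<le> M * dist (h x) (h y)" using M S by simp
    also have "\<dots> \<le> M * (N * dist x y)" using N[OF xy] M(1) by (intro mult_left_mono) (auto simp: dist_norm)
    finally show "norm (g (h x) - g (h y)) \<le> (M * N) * dist x y" by (simp add: algebra_simps)
  qed
qed

lemma bounded_lipschitz_on_inverse:
  fixes g :: "'a::metric_space \<Rightarrow> real"
  assumes g: "bounded_lipschitz_on S g" and "\<delta> > 0" and \<delta>: "\<And>x. x \<in> S \<Longrightarrow> g x \<ge> \<delta>"
  shows "bounded_lipschitz_on S (\<lambda>x. inverse (g x))"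
proof -
  obtain M where M: "M \<ge> 0" "\<And>x y. x \<in> S \<Longrightarrow> y \<in> S \<Longrightarrow> norm (g x - g y) \<le> M * dist x y"
    using bounded_lipschitz_onE[OF g] by metis
  show ?thesis
  proof (rule bounded_lipschitz_onI)
    fix x y assume xy: "x \<in> S" "y \<in> S"
    then have pos: "g x > 0" "g y > 0" using \<delta> \<open>\<delta> > 0\<close> by force+
    have inv: "inverse (g x) \<le> inverse \<delta>" "inverse (g y) \<le> inverse \<delta>"
      using \<delta> xy \<open>\<delta> > 0\<close> by (auto intro!: le_imp_inverse_le)
    then show "norm (inverse (g x)) \<le> inverse \<delta>" using pos by simp
    have "norm (inverse (g x) - inverse (g y)) = inverse (g x) * norm (g x - g y) * inverse (g y)"
      using pos inverse_diff_inverse[of "g x" "g y"] by (simp add: abs_mult)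
    also have "\<dots> \<le> inverse \<delta> * (M * dist x y) * inverse \<delta>"
      using inv pos M xy \<open>\<delta> > 0\<close> by (intro mult_mono) auto
    finally show "norm (inverse (g x) - inverse (g y)) \<le> (inverse \<delta> * M * inverse \<delta>) * dist x y"
      by (simp add: algebra_simps)
  qed
qed

text \<open>The maximum is half of the sum plus half of the absolute difference, and the absolute
  value is 1-Lipschitz.\<close>

lemma bounded_lipschitz_on_max:
  fixes g h :: "'a::metric_space \<Rightarrow> real"
  assumes "bounded_lipschitz_on S g" "bounded_lipschitz_on S h"
  shows "bounded_lipschitz_on S (\<lambda>x. max (g x) (h x))"
proof -
  have "bounded_lipschitz_on S (\<lambda>x. \<bar>g x - h x\<bar>)"
  proof -
    obtain M where "\<And>x. x \<in> S \<Longrightarrow> norm (g x - h x) \<le> M"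
      "\<And>x y. x \<in> S \<Longrightarrow> y \<in> S \<Longrightarrow> norm (g x - h x - (g y - h y)) \<le> M * dist x y"
      using bounded_lipschitz_onE[OF bounded_lipschitz_on_diff[OF assms]] by metis
    then show ?thesis
      by (intro bounded_lipschitz_onI[of _ _ M M]) (auto intro: order_trans[OF abs_triangle_ineq3])
  qed
  then have "bounded_lipschitz_on S (\<lambda>x. (1/2) * (g x + h x + \<bar>g x - h x\<bar>))"
    by (intro bounded_lipschitz_on_mult bounded_lipschitz_on_const bounded_lipschitz_on_add assms)
  moreover have "(\<lambda>x. (1/2) * (g x + h x + \<bar>g x - h x\<bar>)) = (\<lambda>x. max (g x) (h x))"
    by (auto simp: fun_eq_iff max_def)
  ultimately show ?thesis by simp
qed

lemma bounded_lipschitz_on_min: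
  fixes g h :: "'a::metric_space \<Rightarrow> real"
  assumes "bounded_lipschitz_on S g" "bounded_lipschitz_on S h"
  shows "bounded_lipschitz_on S (\<lambda>x. min (g x) (h x))"
proof -
  have "(\<lambda>x. min (g x) (h x)) = (\<lambda>x. - max (- g x) (- h x))"
    by (auto simp: fun_eq_iff)
  then show ?thesis
    using assms by (simp only: bounded_lipschitz_on_minus bounded_lipschitz_on_max)
qed

lemma bounded_lipschitz_on_Pair:
  assumes "bounded_lipschitz_on S g" "bounded_lipschitz_on S h"
  shows "bounded_lipschitz_on S (\<lambda>x. (g x, h x))"
proof -
  have "bounded_linear (\<lambda>x. (x, 0))" "bounded_linear (\<lambda>x. (0, x))"
    by (intro bounded_linear_Pair bounded_linear_ident bounded_linear_zero)+
  from this[THEN bounded_lipschitz_on_linear] bounded_lipschitz_on_add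
  have "bounded_lipschitz_on S (\<lambda>x. (g x, 0) + (0, h x))" using assms by blast
  then show ?thesis by simp
qed

text \<open>This is the integrating factor of the Gronwall argument; the product with it has to
  remain Lipschitz. The estimate rests on \<open>1 - exp (- h) \<le> h\<close>.\<close>

lemma bounded_lipschitz_on_exp_minus:
  fixes K :: real
  assumes "K \<ge> 0"
  shows "bounded_lipschitz_on {0..T} (\<lambda>t. exp (- (K * t)))"
proof (rule bounded_lipschitz_onI[of _ _ 1 K])
  have *: "\<bar>exp (- (K * s)) - exp (- (K * t))\<bar> \<le> K * (t - s)" if "0 \<le> s" "s \<le> t" for s t
  proof -
    have "exp (- (K * t)) = exp (- (K * s)) * exp (- (K * (t - s)))"
      by (simp add: exp_add[symmetric] algebra_simps)
    then have eq: "exp (- (K * s)) - exp (- (K * t)) = exp (- (K * s)) * (1 - exp (- (K * (t - s))))"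
      by (simp add: algebra_simps)
    have "K * (t - s) \<ge> 0" "K * s \<ge> 0" using assms that by auto
    moreover have "1 - exp (- (K * (t - s))) \<le> K * (t - s)"
      using exp_ge_add_one_self[of "- (K * (t - s))"] by linarith
    ultimately have "0 \<le> 1 - exp (- (K * (t - s)))" "1 - exp (- (K * (t - s))) \<le> K * (t - s)"
      "exp (- (K * s)) \<le> 1"
      by auto
    then have "exp (- (K * s)) * (1 - exp (- (K * (t - s)))) \<le> 1 * (K * (t - s))"
      "exp (- (K * s)) * (1 - exp (- (K * (t - s)))) \<ge> 0"
      by (intro mult_mono mult_nonneg_nonneg; simp)+
    then show ?thesis by (simp add: eq)
  qed
  show "norm (exp (- (K * s)) - exp (- (K * t))) \<le> K * dist s t" if "s \<in> {0..T}" "t \<in> {0..T}" for s t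
    using *[of s t] *[of t s] that by (cases "s \<le> t") (auto simp: dist_real_def abs_minus_commute)
qed (use assms in auto)

lemmas bounded_lipschitz_on_intros =
  bounded_lipschitz_on_const bounded_lipschitz_on_add bounded_lipschitz_on_diff
  bounded_lipschitz_on_minus bounded_lipschitz_on_mult bounded_lipschitz_on_scaleR
  bounded_lipschitz_on_inner bounded_lipschitz_on_max bounded_lipschitz_on_min
  bounded_lipschitz_on_Pair

section \<open>Monotonicity, Gronwall estimates and uniqueness for Lipschitz equations\<close>

lemma bounded_lipschitz_mono:
  fixes g :: "real \<Rightarrow> real"
  assumes g: "bounded_lipschitz_on {a..b} g" and "a \<le> s" "s \<le> t" "t \<le> b"
    and deriv: "AE u in lebesgue. a < u \<longrightarrow> u < b \<longrightarrow> (\<exists>d\<ge>0. (g has_real_derivative d) (at u))"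
  shows "g s \<le> g t"
proof (rule abs_continuous_imp_mono[of s t g])
  obtain M where M: "M \<ge> 0" "\<And>x y. x \<in> {a..b} \<Longrightarrow> y \<in> {a..b} \<Longrightarrow> norm (g x - g y) \<le> M * dist x y"
    using bounded_lipschitz_onE[OF g] by metis
  have "M-lipschitz_on {s..t} g"
    using M assms(2-4) by (intro lipschitz_onI) (auto simp: dist_norm)
  then show "abs_continuous_on_interval s t g" by (rule abs_continuous_on_interval_lipschitz)
  show "AE u in lebesgue. s < u \<longrightarrow> u < t \<longrightarrow> (\<exists>d\<ge>0. (g has_real_derivative d) (at u))"
    using deriv by eventually_elim (use assms(2-4) in auto)
qed fact

lemma bounded_lipschitz_growth:
  fixes g :: "real \<Rightarrow> real"
  assumes g: "bounded_lipschitz_on {0..T} g" and t: "t \<in> {0..T}"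
    and deriv: "AE u in lebesgue. 0 < u \<longrightarrow> u < T \<longrightarrow> (\<exists>d\<ge>m. (g has_real_derivative d) (at u))"
  shows "g 0 + m * t \<le> g t"
proof -
  have "g 0 - m * 0 \<le> g t - m * t"
  proof (rule bounded_lipschitz_mono[where g="\<lambda>t. g t - m * t" and a=0 and b=T])
    show "bounded_lipschitz_on {0..T} (\<lambda>t. g t - m * t)"
      by (intro bounded_lipschitz_on_intros g bounded_lipschitz_on_id) auto
    show "AE u in lebesgue. 0 < u \<longrightarrow> u < T \<longrightarrow> (\<exists>d\<ge>0. ((\<lambda>t. g t - m * t) has_real_derivative d) (at u))"
      using deriv
    proof eventually_elim
      case (elim u)
      show ?case
      proof (intro impI)
        assume "0 < u" "u < T"
        with elim obtain d where d: "d \<ge> m" "(g has_real_derivative d) (at u)" by auto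
        have "((\<lambda>t. g t - m * t) has_real_derivative d - m) (at u)"
          by (rule derivative_eq_intros d | simp)+
        with d(1) show "\<exists>d\<ge>0. ((\<lambda>t. g t - m * t) has_real_derivative d) (at u)"
          by (intro exI[of _ "d - m"]) simp
      qed
    qed
  qed (use t in auto)
  then show ?thesis by simp
qed

text \<open>The differential inequality makes \<open>V t * exp (- (K * t))\<close> nonincreasing.
  The sign is reversed in \<open>?W\<close> because the monotonicity lemma speaks of growth.\<close>

lemma gronwall_le_zero:
  fixes V :: "real \<Rightarrow> real"
  assumes V: "bounded_lipschitz_on {0..T} V" and "V 0 \<le> 0" and "K \<ge> 0" and t: "t \<in> {0..T}"
    and deriv: "AE u in lebesgue. 0 < u \<longrightarrow> u < T \<longrightarrow> (\<exists>d. (V has_real_derivative d) (at u) \<and> d \<le> K * V u)"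
  shows "V t \<le> 0"
proof -
  let ?W = "\<lambda>t. - (V t * exp (- (K * t)))"
  have "?W 0 \<le> ?W t"
  proof (rule bounded_lipschitz_mono[where g="?W" and a=0 and b=T])
    show "bounded_lipschitz_on {0..T} ?W"
      by (intro bounded_lipschitz_on_intros V bounded_lipschitz_on_exp_minus \<open>K \<ge> 0\<close>)
    show "AE u in lebesgue. 0 < u \<longrightarrow> u < T \<longrightarrow> (\<exists>d\<ge>0. (?W has_real_derivative d) (at u))"
      using deriv
    proof eventually_elim
      case (elim u)
      show ?case
      proof (intro impI)
        assume "0 < u" "u < T"
        with elim obtain d where d: "d \<le> K * V u" "(V has_real_derivative d) (at u)" by auto
        have "(?W has_real_derivative (K * V u - d) * exp (- (K * u))) (at u)"
          by (auto intro!: derivative_eq_intros d(2) simp: algebra_simps)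
        with d(1) show "\<exists>d\<ge>0. (?W has_real_derivative d) (at u)"
          by (intro exI[of _ "(K * V u - d) * exp (- (K * u))"]) simp
      qed
    qed
  qed (use t in auto)
  then have "V t * exp (- (K * t)) \<le> 0" using \<open>V 0 \<le> 0\<close> by simp
  then show ?thesis by (simp add: mult_le_0_iff)
qed

text \<open>Gronwall for \<open>w t \<bullet> w t\<close>. Only an upper bound on
  \<open>w u \<bullet> v\<close> is assumed, not one on the norm of \<open>v\<close>: this is the
  one-sided Lipschitz condition, which a discontinuous field can satisfy.\<close>

lemma gronwall_eq_zero:
  fixes w :: "real \<Rightarrow> 'a::real_inner"
  assumes w: "bounded_lipschitz_on {0..T} w" and "w 0 = 0" and "K \<ge> 0" and t: "t \<in> {0..T}"
    and deriv: "AE u in lebesgue. 0 < u \<longrightarrow> u < T \<longrightarrow>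
      (\<exists>v. (w has_vector_derivative v) (at u) \<and> w u \<bullet> v \<le> K * (w u \<bullet> w u))"
  shows "w t = 0"
proof -
  have "w t \<bullet> w t \<le> 0"
  proof (rule gronwall_le_zero[of T "\<lambda>t. w t \<bullet> w t" "2 * K"])
    show "AE u in lebesgue. 0 < u \<longrightarrow> u < T \<longrightarrow>
      (\<exists>d. ((\<lambda>t. w t \<bullet> w t) has_real_derivative d) (at u) \<and> d \<le> 2 * K * (w u \<bullet> w u))"
      using deriv
    proof eventually_elim
      case (elim u)
      show ?case
      proof (intro impI)
        assume "0 < u" "u < T"
        with elim obtain v where v: "(w has_vector_derivative v) (at u)" "w u \<bullet> v \<le> K * (w u \<bullet> w u)" by auto
        have "((\<lambda>t. w t \<bullet> w t) has_vector_derivative (w u \<bullet> v + v \<bullet> w u)) (at u)"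
          by (rule bounded_bilinear.has_vector_derivative[OF bounded_bilinear_inner v(1) v(1)])
        then have "((\<lambda>t. w t \<bullet> w t) has_real_derivative 2 * (w u \<bullet> v)) (at u)"
          by (simp add: has_real_derivative_iff_has_vector_derivative inner_commute)
        with v(2) show "\<exists>d. ((\<lambda>t. w t \<bullet> w t) has_real_derivative d) (at u) \<and> d \<le> 2 * K * (w u \<bullet> w u)"
          by (intro exI[of _ "2 * (w u \<bullet> v)"]) simp
      qed
    qed
  qed (use assms in \<open>auto intro: bounded_lipschitz_on_intros\<close>)
  then show ?thesis by (metis inner_ge_zero inner_eq_zero_iff order_antisym)
qed

text \<open>Cauchy-Schwarz turns the Lipschitz bound on \<open>\<Phi>\<close> into the one-sided
  bound of the previous lemma. It is applied once all solutions are known to follow a common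
  Lipschitz field almost everywhere.\<close>

lemma lipschitz_ode_unique:
  fixes x y :: "real \<Rightarrow> 'a::real_inner"
  assumes x: "bounded_lipschitz_on {0..T} x" "x ` {0..T} \<subseteq> S"
    and y: "bounded_lipschitz_on {0..T} y" "y ` {0..T} \<subseteq> S"
    and \<Phi>: "bounded_lipschitz_on S \<Phi>" and "x 0 = y 0" and t: "t \<in> {0..T}"
    and dx: "AE u in lebesgue. 0 < u \<longrightarrow> u < T \<longrightarrow> (x has_vector_derivative \<Phi> (x u)) (at u)"
    and dy: "AE u in lebesgue. 0 < u \<longrightarrow> u < T \<longrightarrow> (y has_vector_derivative \<Phi> (y u)) (at u)"
  shows "x t = y t"
proof -
  obtain M where M: "M \<ge> 0" "\<And>p q. p \<in> S \<Longrightarrow> q \<in> S \<Longrightarrow> norm (\<Phi> p - \<Phi> q) \<le> M * dist p q"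
    using bounded_lipschitz_onE[OF \<Phi>] by metis
  have "x t - y t = 0"
  proof (rule gronwall_eq_zero[of T "\<lambda>t. x t - y t" M])
    show "AE u in lebesgue. 0 < u \<longrightarrow> u < T \<longrightarrow> (\<exists>v. ((\<lambda>t. x t - y t) has_vector_derivative v) (at u) \<and>
        (x u - y u) \<bullet> v \<le> M * ((x u - y u) \<bullet> (x u - y u)))"
      using dx dy
    proof eventually_elim
      case (elim u)
      show ?case
      proof (intro impI)
        assume u: "0 < u" "u < T"
        with elim have "((\<lambda>t. x t - y t) has_vector_derivative (\<Phi> (x u) - \<Phi> (y u))) (at u)"
          by (auto intro: derivative_intros)
        moreover have "(x u - y u) \<bullet> (\<Phi> (x u) - \<Phi> (y u)) \<le> M * ((x u - y u) \<bullet> (x u - y u))"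
        proof -
          have "(x u - y u) \<bullet> (\<Phi> (x u) - \<Phi> (y u)) \<le> norm (x u - y u) * norm (\<Phi> (x u) - \<Phi> (y u))"
            by (rule norm_cauchy_schwarz)
          also have "\<dots> \<le> norm (x u - y u) * (M * dist (x u) (y u))"
            using u x(2) y(2) by (intro mult_left_mono M(2)) auto
          finally show ?thesis by (simp add: dist_norm dot_square_norm power2_eq_square algebra_simps)
        qed
        ultimately show "\<exists>v. ((\<lambda>t. x t - y t) has_vector_derivative v) (at u) \<and>
            (x u - y u) \<bullet> v \<le> M * ((x u - y u) \<bullet> (x u - y u))" by blast
      qed
    qed
  qed (use assms M in \<open>auto intro: bounded_lipschitz_on_intros\<close>)
  then show ?thesis by simp
qed

section \<open>Solutions that leave the switching surface\<close>

text \<open>The Filippov inclusion localized to the time interval \<open>{0..T}\<close> and the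
  region \<open>S\<close>, with the weight \<open>l\<close> of mode 1 in the convex hull made
  explicit. Lipschitz continuity takes the place of absolute continuity, since velocities are
  bounded on the balls where the notion is used.\<close>

definition switching_solution ::
  "('a::euclidean_space \<Rightarrow> 'a) \<Rightarrow> ('a \<Rightarrow> 'a) \<Rightarrow> 'a \<Rightarrow> real \<Rightarrow> 'a set \<Rightarrow> real \<Rightarrow> (real \<Rightarrow> 'a) \<Rightarrow> bool"
  where "switching_solution F G c f S T x \<longleftrightarrow>
    bounded_lipschitz_on {0..T} x \<and> x ` {0..T} \<subseteq> S \<and>
    (AE t in lebesgue. 0 < t \<longrightarrow> t < T \<longrightarrow> (\<exists>l. 0 \<le> l \<and> l \<le> 1 \<and>
       (x has_vector_derivative G (x t) + l *\<^sub>R (F (x t) - G (x t))) (at t) \<and>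
       (c \<bullet> x t + f < 0 \<longrightarrow> l = 1) \<and> (c \<bullet> x t + f > 0 \<longrightarrow> l = 0)))"

text \<open>The radius is fixed before the solutions, so that the estimates on one ball serve all of
  them; by continuity every Filippov solution remains in that ball for a short time.\<close>

definition switching_unique ::
  "('a::euclidean_space \<Rightarrow> 'a) \<Rightarrow> ('a \<Rightarrow> 'a) \<Rightarrow> 'a \<Rightarrow> real \<Rightarrow> 'a \<Rightarrow> bool"
  where "switching_unique F G c f \<xi> \<longleftrightarrow>
    (\<exists>r>0. \<forall>T x x'. switching_solution F G c f (cball \<xi> r) T x \<longrightarrow>
       switching_solution F G c f (cball \<xi> r) T x' \<longrightarrow> x 0 = \<xi> \<longrightarrow> x' 0 = \<xi> \<longrightarrow>
       (\<forall>t\<in>{0..T}. x t = x' t))"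

text \<open>Exchanging the modes reverses the sign of the switching function and replaces
  \<open>l\<close> by \<open>1 - l\<close>. This symmetry saves the mirrored cases.\<close>

lemma switching_solution_swap:
  assumes "switching_solution F G c f S T x"
  shows "switching_solution G F (- c) (- f) S T x"
  unfolding switching_solution_def
proof (intro conjI)
  have "AE t in lebesgue. 0 < t \<longrightarrow> t < T \<longrightarrow> (\<exists>l. 0 \<le> l \<and> l \<le> 1 \<and>
       (x has_vector_derivative G (x t) + l *\<^sub>R (F (x t) - G (x t))) (at t) \<and>
       (c \<bullet> x t + f < 0 \<longrightarrow> l = 1) \<and> (c \<bullet> x t + f > 0 \<longrightarrow> l = 0))"
    using assms by (simp add: switching_solution_def)
  then show "AE t in lebesgue. 0 < t \<longrightarrow> t < T \<longrightarrow> (\<exists>l. 0 \<le> l \<and> l \<le> 1 \<and>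
       (x has_vector_derivative F (x t) + l *\<^sub>R (G (x t) - F (x t))) (at t) \<and>
       (- c \<bullet> x t + - f < 0 \<longrightarrow> l = 1) \<and> (- c \<bullet> x t + - f > 0 \<longrightarrow> l = 0))"
  proof eventually_elim
    case (elim t)
    show ?case
    proof (intro impI)
      assume "0 < t" "t < T"
      with elim obtain l where l: "0 \<le> l" "l \<le> 1"
        "(x has_vector_derivative G (x t) + l *\<^sub>R (F (x t) - G (x t))) (at t)"
        "c \<bullet> x t + f < 0 \<longrightarrow> l = 1" "c \<bullet> x t + f > 0 \<longrightarrow> l = 0" by blast
      have "G (x t) + l *\<^sub>R (F (x t) - G (x t)) = F (x t) + (1 - l) *\<^sub>R (G (x t) - F (x t))"
        by (simp add: algebra_simps)
      with l(3) have "(x has_vector_derivative F (x t) + (1 - l) *\<^sub>R (G (x t) - F (x t))) (at t)"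
        by simp
      with l(1,2,4,5) show "\<exists>l. 0 \<le> l \<and> l \<le> 1 \<and>
         (x has_vector_derivative F (x t) + l *\<^sub>R (G (x t) - F (x t))) (at t) \<and>
         (- c \<bullet> x t + - f < 0 \<longrightarrow> l = 1) \<and> (- c \<bullet> x t + - f > 0 \<longrightarrow> l = 0)"
        by (intro exI[of _ "1 - l"]) auto
    qed
  qed
qed (use assms in \<open>auto simp: switching_solution_def\<close>)

lemma switching_unique_swap:
  assumes "switching_unique G F (- c) (- f) \<xi>"
  shows "switching_unique F G c f \<xi>"
  using assms switching_solution_swap unfolding switching_unique_def by metis

section \<open>Growth estimates near a point and exit into one mode\<close>

lemma positive_near:
  fixes \<phi> :: "'a::real_normed_vector \<Rightarrow> real"
  assumes "bounded_lipschitz_on (cball \<xi> 1) \<phi>" and pos: "\<phi> \<xi> > 0"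
  obtains r \<delta> where "0 < r" "r \<le> 1" "0 < \<delta>" "\<And>x. x \<in> cball \<xi> r \<Longrightarrow> \<phi> x \<ge> \<delta>"
proof -
  obtain M where M: "M \<ge> 0" "\<And>x y. x \<in> cball \<xi> 1 \<Longrightarrow> y \<in> cball \<xi> 1 \<Longrightarrow> norm (\<phi> x - \<phi> y) \<le> M * dist x y"
    using bounded_lipschitz_onE[OF assms(1)] by metis
  \<comment> \<open>The radius is chosen so that \<open>\<phi>\<close> varies by at most half of
    \<open>\<phi> \<xi>\<close> on the ball; the other half becomes \<open>\<delta>\<close>.\<close>
  define r where "r = min 1 (\<phi> \<xi> / (2 * (M + 1)))"
  have r: "0 < r" "r \<le> 1" using pos M(1) by (auto simp: r_def)
  have "M * r \<le> (M + 1) * (\<phi> \<xi> / (2 * (M + 1)))"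
    using M(1) r by (intro mult_mono) (auto simp: r_def)
  also have "\<dots> = \<phi> \<xi> / 2" using M(1) by (simp add: field_simps add_nonneg_eq_0_iff)
  finally have Mr: "M * r \<le> \<phi> \<xi> / 2" .
  have "\<phi> x \<ge> \<phi> \<xi> / 2" if "x \<in> cball \<xi> r" for x
  proof -
    have "\<bar>\<phi> x - \<phi> \<xi>\<bar> \<le> M * dist x \<xi>" using M(2)[of x \<xi>] that r by auto
    also have "\<dots> \<le> M * r" using that M(1) by (intro mult_left_mono) (auto simp: dist_commute)
    finally show ?thesis using Mr by linarith
  qed
  then show ?thesis using that[of r "\<phi> \<xi> / 2"] r pos by auto
qed

lemma bounded_lipschitz_on_affine:
  fixes \<xi> b :: "'a::real_inner"
  shows "bounded_lipschitz_on (cball \<xi> r) (\<lambda>x. b \<bullet> x + k)"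
  by (intro bounded_lipschitz_on_intros bounded_lipschitz_on_id) auto

lemma has_real_derivative_affine:
  fixes x :: "real \<Rightarrow> 'a::real_inner"
  assumes "(x has_vector_derivative v) F"
  shows "((\<lambda>t. b \<bullet> x t + k) has_real_derivative b \<bullet> v) F"
proof -
  have "((\<lambda>t. b \<bullet> x t) has_vector_derivative b \<bullet> v) F"
    by (rule bounded_linear.has_vector_derivative[OF bounded_linear_inner_right assms])
  then show ?thesis
    by (auto simp: has_real_derivative_iff_has_vector_derivative[symmetric] intro!: derivative_eq_intros)
qed

text \<open>Whatever the weight \<open>l\<close>, the derivative of \<open>b \<bullet> x t\<close>
  is a convex combination of \<open>b \<bullet> F\<close> and \<open>b \<bullet> G\<close>, hence at
  least \<open>\<delta>\<close>.\<close>

lemma switching_solution_affine_growth: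
  assumes x: "switching_solution F G c f S T x" and t: "t \<in> {0..T}"
    and F: "\<And>x. x \<in> S \<Longrightarrow> b \<bullet> F x \<ge> \<delta>" and G: "\<And>x. x \<in> S \<Longrightarrow> b \<bullet> G x \<ge> \<delta>"
  shows "b \<bullet> x 0 + k + \<delta> * t \<le> b \<bullet> x t + k"
proof (rule bounded_lipschitz_growth[where g="\<lambda>t. b \<bullet> x t + k", OF _ t])
  have xl: "bounded_lipschitz_on {0..T} x" and xS: "x ` {0..T} \<subseteq> S"
    and ae: "AE t in lebesgue. 0 < t \<longrightarrow> t < T \<longrightarrow> (\<exists>l. 0 \<le> l \<and> l \<le> 1 \<and>
       (x has_vector_derivative G (x t) + l *\<^sub>R (F (x t) - G (x t))) (at t) \<and>
       (c \<bullet> x t + f < 0 \<longrightarrow> l = 1) \<and> (c \<bullet> x t + f > 0 \<longrightarrow> l = 0))"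
    using x by (auto simp: switching_solution_def)
  show "bounded_lipschitz_on {0..T} (\<lambda>t. b \<bullet> x t + k)"
    by (intro bounded_lipschitz_on_intros xl)
  show "AE u in lebesgue. 0 < u \<longrightarrow> u < T \<longrightarrow> (\<exists>d\<ge>\<delta>. ((\<lambda>t. b \<bullet> x t + k) has_real_derivative d) (at u))"
    using ae
  proof eventually_elim
    case (elim u)
    show ?case
    proof (intro impI)
      assume u: "0 < u" "u < T"
      with elim obtain l where l: "0 \<le> l" "l \<le> 1"
        "(x has_vector_derivative G (x u) + l *\<^sub>R (F (x u) - G (x u))) (at u)" by blast
      have S: "x u \<in> S" using xS u by auto
      have "b \<bullet> (G (x u) + l *\<^sub>R (F (x u) - G (x u))) - \<delta> = (1 - l) * (b \<bullet> G (x u) - \<delta>) + l * (b \<bullet> F (x u) - \<delta>)"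
        by (simp add: inner_add_right inner_diff_right algebra_simps)
      moreover have "\<dots> \<ge> 0" using l F[OF S] G[OF S] by simp
      ultimately have "b \<bullet> (G (x u) + l *\<^sub>R (F (x u) - G (x u))) \<ge> \<delta>" by linarith
      then show "\<exists>d\<ge>\<delta>. ((\<lambda>t. b \<bullet> x t + k) has_real_derivative d) (at u)"
        using has_real_derivative_affine[OF l(3)] by blast
    qed
  qed
qed

text \<open>Positivity of the switching function after time 0 forces \<open>l = 0\<close> almost
  everywhere, so every solution solves the Lipschitz equation with field \<open>G\<close>.\<close>

lemma switching_unique_if_leaves:
  assumes G: "bounded_lipschitz_on (cball \<xi> 1) G" and "0 < r" "r \<le> 1"
    and pos: "\<And>T x t. switching_solution F G c f (cball \<xi> r) T x \<Longrightarrow> x 0 = \<xi> \<Longrightarrow> 0 < t \<Longrightarrow> t < T \<Longrightarrow> c \<bullet> x t + f > 0"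
  shows "switching_unique F G c f \<xi>"
  unfolding switching_unique_def
proof (intro exI[of _ r] conjI allI impI ballI)
  fix T x x' t
  assume x: "switching_solution F G c f (cball \<xi> r) T x" and x': "switching_solution F G c f (cball \<xi> r) T x'"
    and "x 0 = \<xi>" "x' 0 = \<xi>" and t: "t \<in> {0..T}"
  have *: "AE t in lebesgue. 0 < t \<longrightarrow> t < T \<longrightarrow> (z has_vector_derivative G (z t)) (at t)"
    if z: "switching_solution F G c f (cball \<xi> r) T z" and "z 0 = \<xi>" for z
  proof -
    have "AE t in lebesgue. 0 < t \<longrightarrow> t < T \<longrightarrow> (\<exists>l. 0 \<le> l \<and> l \<le> 1 \<and>
       (z has_vector_derivative G (z t) + l *\<^sub>R (F (z t) - G (z t))) (at t) \<and>
       (c \<bullet> z t + f < 0 \<longrightarrow> l = 1) \<and> (c \<bullet> z t + f > 0 \<longrightarrow> l = 0))"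
      using z by (auto simp: switching_solution_def)
    then show ?thesis
    proof eventually_elim
      case (elim t)
      then show ?case using pos[OF z \<open>z 0 = \<xi>\<close>, of t] by auto
    qed
  qed
  have "bounded_lipschitz_on (cball \<xi> r) G"
    using G \<open>r \<le> 1\<close> by (auto intro: bounded_lipschitz_on_subset)
  then show "x t = x' t"
    using x x' \<open>x 0 = \<xi>\<close> \<open>x' 0 = \<xi>\<close> t *[of x] *[of x']
    by (intro lipschitz_ode_unique[of T x "cball \<xi> r" x' G t]) (auto simp: switching_solution_def)
qed fact

lemma switching_unique_off_surface:
  assumes G: "bounded_lipschitz_on (cball \<xi> 1) G" and pos: "c \<bullet> \<xi> + f > 0"
  shows "switching_unique F G c f \<xi>"
proof -
  obtain r \<delta> where r: "0 < r" "r \<le> 1" "0 < \<delta>" "\<And>x. x \<in> cball \<xi> r \<Longrightarrow> c \<bullet> x + f \<ge> \<delta>"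
    using positive_near[OF bounded_lipschitz_on_affine pos] by blast
  show ?thesis
  proof (rule switching_unique_if_leaves[OF G r(1,2)])
    fix T x t assume "switching_solution F G c f (cball \<xi> r) T x" "x 0 = \<xi>" "0 < t" "t < T"
    then have "x t \<in> cball \<xi> r" unfolding switching_solution_def by (simp add: image_subset_iff del: mem_cball)
    then show "c \<bullet> x t + f > 0" using r(3,4) by force
  qed
qed

text \<open>Both modes push the switching function upward at a rate of at least
  \<open>\<delta>\<close> near \<open>\<xi>\<close>, so it grows at least linearly from 0.\<close>

lemma switching_unique_transversal:
  assumes F: "bounded_lipschitz_on (cball \<xi> 1) F" and G: "bounded_lipschitz_on (cball \<xi> 1) G"
    and "c \<bullet> \<xi> + f = 0" and pos: "c \<bullet> F \<xi> > 0" "c \<bullet> G \<xi> > 0"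
  shows "switching_unique F G c f \<xi>"
proof -
  have "bounded_lipschitz_on (cball \<xi> 1) (\<lambda>x. min (c \<bullet> F x) (c \<bullet> G x))"
    by (intro bounded_lipschitz_on_intros F G)
  then obtain r \<delta> where r: "0 < r" "r \<le> 1" "0 < \<delta>" "\<And>x. x \<in> cball \<xi> r \<Longrightarrow> min (c \<bullet> F x) (c \<bullet> G x) \<ge> \<delta>"
    using positive_near[of \<xi> "\<lambda>x. min (c \<bullet> F x) (c \<bullet> G x)"] pos by auto
  show ?thesis
  proof (rule switching_unique_if_leaves[OF G r(1,2)])
    fix T x t assume x: "switching_solution F G c f (cball \<xi> r) T x" "x 0 = \<xi>" "0 < t" "t < T"
    have "c \<bullet> x 0 + f + \<delta> * t \<le> c \<bullet> x t + f"
      by (rule switching_solution_affine_growth[OF x(1)]) (use r(4) x in auto)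
    moreover have "\<delta> * t > 0" using r(3) x(3) by simp
    ultimately show "c \<bullet> x t + f > 0" using x(2) assms(3) by auto
  qed
qed

text \<open>The four sign conditions make \<open>c \<bullet> F\<close> and
  \<open>c \<bullet> G\<close> both grow at least like \<open>\<delta> * s\<close> along any mixture
  of the modes; integrating once more, the switching function is at least
  \<open>\<delta> / 2 * t\<^sup>2\<close>.\<close>

lemma switching_unique_second_order:
  assumes F: "bounded_lipschitz_on (cball \<xi> 1) F" and G: "bounded_lipschitz_on (cball \<xi> 1) G"
    and "c \<bullet> \<xi> + f = 0"
    and cF: "\<And>x. c \<bullet> F x = b1 \<bullet> x + k1" and cG: "\<And>x. c \<bullet> G x = b2 \<bullet> x + k2"
    and zero: "c \<bullet> F \<xi> = 0" "c \<bullet> G \<xi> = 0"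
    and pos: "b1 \<bullet> F \<xi> > 0" "b1 \<bullet> G \<xi> > 0" "b2 \<bullet> F \<xi> > 0" "b2 \<bullet> G \<xi> > 0"
  shows "switching_unique F G c f \<xi>"
proof -
  let ?m = "\<lambda>x. min (min (b1 \<bullet> F x) (b1 \<bullet> G x)) (min (b2 \<bullet> F x) (b2 \<bullet> G x))"
  have "bounded_lipschitz_on (cball \<xi> 1) ?m"
    by (intro bounded_lipschitz_on_intros F G)
  then obtain r \<delta> where r: "0 < r" "r \<le> 1" "0 < \<delta>" "\<And>x. x \<in> cball \<xi> r \<Longrightarrow> ?m x \<ge> \<delta>"
    using positive_near[of \<xi> ?m] pos by auto
  show ?thesis
  proof (rule switching_unique_if_leaves[OF G r(1,2)])
    fix T x t assume x: "switching_solution F G c f (cball \<xi> r) T x" "x 0 = \<xi>" "0 < t" "t < T"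
    have z: "c \<bullet> F (x s) \<ge> \<delta> * s \<and> c \<bullet> G (x s) \<ge> \<delta> * s" if "s \<in> {0..T}" for s
    proof -
      have "b1 \<bullet> x 0 + k1 + \<delta> * s \<le> b1 \<bullet> x s + k1" "b2 \<bullet> x 0 + k2 + \<delta> * s \<le> b2 \<bullet> x s + k2"
        by (rule switching_solution_affine_growth[OF x(1)]; use r(4) that in force)+
      then show ?thesis using zero x(2) cF cG by auto
    qed
    have xl: "bounded_lipschitz_on {0..T} x"
      and ae: "AE t in lebesgue. 0 < t \<longrightarrow> t < T \<longrightarrow> (\<exists>l. 0 \<le> l \<and> l \<le> 1 \<and>
         (x has_vector_derivative G (x t) + l *\<^sub>R (F (x t) - G (x t))) (at t) \<and>
         (c \<bullet> x t + f < 0 \<longrightarrow> l = 1) \<and> (c \<bullet> x t + f > 0 \<longrightarrow> l = 0))"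
      using x(1) by (auto simp: switching_solution_def)
    let ?g = "\<lambda>t. c \<bullet> x t + f - \<delta> / 2 * (t * t)"
    have "?g 0 + 0 * t \<le> ?g t"
    proof (rule bounded_lipschitz_growth[where T=T])
      show "bounded_lipschitz_on {0..T} ?g"
        by (intro bounded_lipschitz_on_intros xl bounded_lipschitz_on_id) auto
      show "AE u in lebesgue. 0 < u \<longrightarrow> u < T \<longrightarrow> (\<exists>d\<ge>0. (?g has_real_derivative d) (at u))"
        using ae
      proof eventually_elim
        case (elim u)
        show ?case
        proof (intro impI)
          assume u: "0 < u" "u < T"
          with elim obtain l where l: "0 \<le> l" "l \<le> 1"
            "(x has_vector_derivative G (x u) + l *\<^sub>R (F (x u) - G (x u))) (at u)" by blast
          let ?d = "c \<bullet> (G (x u) + l *\<^sub>R (F (x u) - G (x u))) - \<delta> * u"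
          have "(?g has_real_derivative ?d) (at u)"
            by (auto intro!: derivative_eq_intros has_real_derivative_affine[OF l(3), where k=0, simplified])
          moreover have "?d = (1 - l) * (c \<bullet> G (x u) - \<delta> * u) + l * (c \<bullet> F (x u) - \<delta> * u)"
            by (simp add: inner_add_right inner_diff_right algebra_simps)
          moreover have "\<dots> \<ge> 0" using l z[of u] u by simp
          ultimately have "?d \<ge> 0" by linarith
          with \<open>(?g has_real_derivative ?d) (at u)\<close> show "\<exists>d\<ge>0. (?g has_real_derivative d) (at u)"
            by (intro exI[of _ ?d] conjI)
        qed
      qed
    qed (use x in auto)
    moreover have "\<delta> / 2 * (t * t) > 0" using r(3) x(3) by simp
    ultimately show "c \<bullet> x t + f > 0" using x(2) assms(3) by auto
  qed
qed

section \<open>First-order sliding\<close>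

text \<open>The quotient rule for an affine field \<open>g\<close> scaled so that its component
  along \<open>c\<close> becomes 1; it supplies the derivative of \<open>h\<close> in the change of
  coordinates below.\<close>

lemma has_vector_derivative_normalized:
  fixes x :: "real \<Rightarrow> 'a::real_inner"
  assumes x: "(x has_vector_derivative v) (at t)" and B: "bounded_linear B"
    and g: "\<And>z. g z = B z + g0" and D: "c \<bullet> g (x t) \<noteq> 0"
  shows "((\<lambda>t. inverse (c \<bullet> g (x t)) *\<^sub>R g (x t)) has_vector_derivative
    inverse (c \<bullet> g (x t)) *\<^sub>R B v - (inverse (c \<bullet> g (x t)) * inverse (c \<bullet> g (x t)) * (c \<bullet> B v)) *\<^sub>R g (x t)) (at t)"
proof -
  have gd: "((\<lambda>t. g (x t)) has_vector_derivative B v) (at t)"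
    unfolding g using bounded_linear.has_vector_derivative[OF B x] by (auto intro!: derivative_eq_intros)
  have "((\<lambda>t. c \<bullet> g (x t)) has_real_derivative c \<bullet> B v) (at t)"
    using has_real_derivative_affine[OF gd, of c 0] by simp
  then have "((\<lambda>t. inverse (c \<bullet> g (x t))) has_real_derivative
      - (inverse (c \<bullet> g (x t)) * (c \<bullet> B v) * inverse (c \<bullet> g (x t)))) (at t)"
    using D by (rule DERIV_inverse')
  from has_vector_derivative_scaleR[OF this gd] show ?thesis
    by (simp add: algebra_simps)
qed

text \<open>
  The coordinate \<open>u = x - y h(x)\<close> with \<open>y = c \<bullet> x + f\<close> and \<open>h = (F - G) / (c \<bullet> (F - G))\<close> eliminates
  the weight \<open>l\<close>: along a solution \<open>u\<close> satisfies a Lipschitz equation, because \<open>y * l = min y 0\<close>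
  whatever \<open>l\<close> is on the surface. In the remaining coordinate \<open>y\<close>, two solutions satisfy
  \<open>(y - y') * (l - l') \<le> 0\<close>, which is the favourable sign when \<open>c \<bullet> (F - G) > 0\<close>.
\<close>

lemma switching_unique_attractive:
  fixes \<xi> :: "'a::euclidean_space"
  assumes F: "bounded_lipschitz_on (cball \<xi> 1) F" and G: "bounded_lipschitz_on (cball \<xi> 1) G"
    and B: "bounded_linear B" and FG: "\<And>x. F x - G x = B x + g0"
    and zero: "c \<bullet> \<xi> + f = 0" and attr: "c \<bullet> F \<xi> > c \<bullet> G \<xi>"
  shows "switching_unique F G c f \<xi>"
proof -
  interpret B: bounded_linear B by fact
  define g where "g = (\<lambda>x. F x - G x)"
  define D where "D = (\<lambda>x. c \<bullet> g x)"
  define y where "y = (\<lambda>x. c \<bullet> x + f)"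
  define h where "h = (\<lambda>x. inverse (D x) *\<^sub>R g x)"
  \<comment> \<open>\<open>q\<close> is \<open>y\<close> times the velocity, with the product
    \<open>y * l\<close> already replaced by \<open>min y 0\<close>; \<open>\<Phi>\<close> is then
    the right-hand side of the equation for \<open>u\<close>.\<close>
  define q where "q = (\<lambda>x. y x *\<^sub>R G x + min (y x) 0 *\<^sub>R g x)"
  define \<Phi> where "\<Phi> = (\<lambda>x. G x - (c \<bullet> G x) *\<^sub>R h x -
    (inverse (D x) *\<^sub>R B (q x) - (inverse (D x) * inverse (D x) * (c \<bullet> B (q x))) *\<^sub>R g x))"
  have g1: "bounded_lipschitz_on (cball \<xi> 1) g" and D1: "bounded_lipschitz_on (cball \<xi> 1) D"
    unfolding D_def g_def by (intro bounded_lipschitz_on_intros F G)+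
  have "D \<xi> > 0" using attr by (simp add: D_def g_def inner_diff_right)
  from positive_near[OF D1 this] obtain r0 \<delta> where r0: "0 < r0" "r0 \<le> 1" "0 < \<delta>"
    and D\<delta>: "\<And>x. x \<in> cball \<xi> r0 \<Longrightarrow> D x \<ge> \<delta>" by blast
  have sub: "bounded_lipschitz_on (cball \<xi> r0) k" if "bounded_lipschitz_on (cball \<xi> 1) k" for k :: "'a \<Rightarrow> 'b::real_normed_vector"
    using that r0 by (auto intro: bounded_lipschitz_on_subset)
  have invD: "bounded_lipschitz_on (cball \<xi> r0) (\<lambda>x. inverse (D x))"
    using sub[OF D1] r0(3) D\<delta> by (rule bounded_lipschitz_on_inverse)
  have yl: "bounded_lipschitz_on (cball \<xi> r0) y"
    unfolding y_def by (rule bounded_lipschitz_on_affine)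
  have hl: "bounded_lipschitz_on (cball \<xi> r0) h"
    unfolding h_def by (intro bounded_lipschitz_on_intros invD sub[OF g1])
  have ql: "bounded_lipschitz_on (cball \<xi> r0) q"
    unfolding q_def by (intro bounded_lipschitz_on_intros yl sub[OF g1] sub[OF G])
  have \<Phi>l: "bounded_lipschitz_on (cball \<xi> r0) \<Phi>"
    unfolding \<Phi>_def
    by (intro bounded_lipschitz_on_intros hl invD sub[OF g1] sub[OF G] bounded_lipschitz_on_linear[OF B] ql)
  obtain Mh where Mh: "Mh \<ge> 0" "\<And>x. x \<in> cball \<xi> r0 \<Longrightarrow> norm (h x) \<le> Mh"
    "\<And>x z. x \<in> cball \<xi> r0 \<Longrightarrow> z \<in> cball \<xi> r0 \<Longrightarrow> norm (h x - h z) \<le> Mh * dist x z"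
    using bounded_lipschitz_onE[OF hl] by metis
  obtain M\<Phi> where M\<Phi>: "M\<Phi> \<ge> 0"
    "\<And>x z. x \<in> cball \<xi> r0 \<Longrightarrow> z \<in> cball \<xi> r0 \<Longrightarrow> norm (\<Phi> x - \<Phi> z) \<le> M\<Phi> * dist x z"
    using bounded_lipschitz_onE[OF \<Phi>l] by metis
  obtain MD where MD: "MD \<ge> 0"
    "\<And>x z. x \<in> cball \<xi> r0 \<Longrightarrow> z \<in> cball \<xi> r0 \<Longrightarrow> norm (D x - D z) \<le> MD * dist x z"
    using bounded_lipschitz_onE[OF sub[OF D1]] by metis
  have "bounded_lipschitz_on (cball \<xi> r0) (\<lambda>x. c \<bullet> G x)"
    by (intro bounded_lipschitz_on_intros sub[OF G])
  then obtain MG where MG: "MG \<ge> 0"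
    "\<And>x z. x \<in> cball \<xi> r0 \<Longrightarrow> z \<in> cball \<xi> r0 \<Longrightarrow> norm (c \<bullet> G x - c \<bullet> G z) \<le> MG * dist x z"
    by (metis bounded_lipschitz_onE)
  \<comment> \<open>Small enough that \<open>\<bar>y\<bar> * Mh \<le> 1 / 2\<close>, which makes the
    map from \<open>x\<close> to the pair of \<open>u\<close> and \<open>y\<close> invertible with a
    Lipschitz inverse.\<close>
  define r where "r = min r0 (1 / (2 * ((norm c + 1) * (Mh + 1))))"
  have prod: "(norm c + 1) * (Mh + 1) > 0" using Mh(1) by (simp add: add_nonneg_pos)
  have r: "0 < r" "r \<le> r0" using r0 prod by (auto simp: r_def)
  have yh: "\<bar>y x\<bar> * Mh \<le> 1 / 2" if "x \<in> cball \<xi> r" for x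
  proof -
    have "y x = c \<bullet> (x - \<xi>)" using zero by (simp add: y_def inner_diff_right)
    then have "\<bar>y x\<bar> \<le> norm c * norm (x - \<xi>)" using Cauchy_Schwarz_ineq2 by simp
    also have "\<dots> \<le> (norm c + 1) * r"
      using that by (intro mult_mono) (auto simp: dist_norm norm_minus_commute)
    finally have "\<bar>y x\<bar> * Mh \<le> ((norm c + 1) * r) * (Mh + 1)"
      using Mh(1) r(1) by (intro mult_mono) auto
    also have "\<dots> = ((norm c + 1) * (Mh + 1)) * r" by simp
    also have "\<dots> \<le> ((norm c + 1) * (Mh + 1)) * (1 / (2 * ((norm c + 1) * (Mh + 1))))"
      using prod by (intro mult_left_mono) (auto simp: r_def)
    also have "\<dots> = 1 / 2"
      using prod by (metis divide_self_if less_irrefl mult.commute mult_1 mult_divide_mult_cancel_right times_divide_eq_right)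
    finally show ?thesis .
  qed
  define C where "C = 2 * (1 + Mh)"
  have "C \<ge> 0" using Mh(1) by (simp add: C_def)
  show ?thesis
    unfolding switching_unique_def
  proof (intro exI[of _ r] conjI allI impI ballI)
    fix T x x' t
    assume "switching_solution F G c f (cball \<xi> r) T x" "switching_solution F G c f (cball \<xi> r) T x'"
      and x0: "x 0 = \<xi>" "x' 0 = \<xi>" and t: "t \<in> {0..T}"
    then have xl: "bounded_lipschitz_on {0..T} x" "bounded_lipschitz_on {0..T} x'"
      and xr: "x ` {0..T} \<subseteq> cball \<xi> r" "x' ` {0..T} \<subseteq> cball \<xi> r"
      and ae: "AE t in lebesgue. 0 < t \<longrightarrow> t < T \<longrightarrow> (\<exists>l. 0 \<le> l \<and> l \<le> 1 \<and>
         (x has_vector_derivative G (x t) + l *\<^sub>R g (x t)) (at t) \<and>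
         (y (x t) < 0 \<longrightarrow> l = 1) \<and> (y (x t) > 0 \<longrightarrow> l = 0))"
      and ae': "AE t in lebesgue. 0 < t \<longrightarrow> t < T \<longrightarrow> (\<exists>l. 0 \<le> l \<and> l \<le> 1 \<and>
         (x' has_vector_derivative G (x' t) + l *\<^sub>R g (x' t)) (at t) \<and>
         (y (x' t) < 0 \<longrightarrow> l = 1) \<and> (y (x' t) > 0 \<longrightarrow> l = 0))"
      by (simp_all add: switching_solution_def g_def y_def)
    have xr0: "x ` {0..T} \<subseteq> cball \<xi> r0" "x' ` {0..T} \<subseteq> cball \<xi> r0"
      using xr subset_cball[OF r(2), of \<xi>] by blast+
    define u where "u = (\<lambda>z. z - y z *\<^sub>R h z)"
    define w where "w = (\<lambda>t. (u (x t) - u (x' t), y (x t) - y (x' t)))"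
    have ul: "bounded_lipschitz_on (cball \<xi> r0) u"
      unfolding u_def by (intro bounded_lipschitz_on_intros bounded_lipschitz_on_id yl hl) simp
    \<comment> \<open>In the splitting of \<open>x s - x' s\<close>, the term with
      \<open>h (x s) - h (x' s)\<close> is at most half of the distance and is absorbed on the left;
      this produces the factor 2 in \<open>C\<close>.\<close>
    have close: "dist (x s) (x' s) \<le> C * norm (w s)" if s: "s \<in> {0..T}" for s
    proof -
      have S: "x s \<in> cball \<xi> r0" "x' s \<in> cball \<xi> r0" "x' s \<in> cball \<xi> r" using s xr xr0 by blast+
      have "x s - x' s = (u (x s) - u (x' s)) + (y (x s) - y (x' s)) *\<^sub>R h (x s) + y (x' s) *\<^sub>R (h (x s) - h (x' s))"
        by (simp add: u_def algebra_simps)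
      then have "norm (x s - x' s) \<le> norm (u (x s) - u (x' s)) + norm ((y (x s) - y (x' s)) *\<^sub>R h (x s)) + norm (y (x' s) *\<^sub>R (h (x s) - h (x' s)))"
        by (metis norm_triangle_le norm_triangle_ineq add_right_mono)
      moreover have "norm (u (x s) - u (x' s)) \<le> norm (w s)"
        unfolding w_def by (rule norm_fst_le)
      moreover have "norm ((y (x s) - y (x' s)) *\<^sub>R h (x s)) \<le> norm (w s) * Mh"
        unfolding norm_scaleR using Mh S norm_snd_le[of "y (x s) - y (x' s)" "u (x s) - u (x' s)"]
        by (intro mult_mono) (auto simp: w_def)
      moreover have "norm (y (x' s) *\<^sub>R (h (x s) - h (x' s))) \<le> \<bar>y (x' s)\<bar> * (Mh * dist (x s) (x' s))"
        unfolding norm_scaleR using Mh(3)[OF S(1,2)] by (intro mult_mono) auto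
      moreover have "\<bar>y (x' s)\<bar> * (Mh * dist (x s) (x' s)) \<le> (1 / 2) * dist (x s) (x' s)"
        using mult_right_mono[OF yh[OF S(3)], of "dist (x s) (x' s)"] by (simp add: mult.assoc)
      ultimately show ?thesis unfolding C_def dist_norm by (simp add: algebra_simps)
    qed
    have du: "((\<lambda>t. u (z t)) has_vector_derivative \<Phi> (z s)) (at s)"
      if z: "(z has_vector_derivative G (z s) + l *\<^sub>R g (z s)) (at s)" "z s \<in> cball \<xi> r0"
        and l: "y (z s) < 0 \<longrightarrow> l = 1" "y (z s) > 0 \<longrightarrow> l = 0" for z s l
    proof -
      let ?v = "G (z s) + l *\<^sub>R g (z s)"
      have Dpos: "D (z s) \<noteq> 0" using D\<delta>[OF z(2)] r0(3) by auto
      have dy: "((\<lambda>t. y (z t)) has_real_derivative c \<bullet> ?v) (at s)"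
        unfolding y_def by (rule has_real_derivative_affine[OF z(1)])
      have dh: "((\<lambda>t. h (z t)) has_vector_derivative inverse (D (z s)) *\<^sub>R B ?v
          - (inverse (D (z s)) * inverse (D (z s)) * (c \<bullet> B ?v)) *\<^sub>R g (z s)) (at s)" (is "(_ has_vector_derivative ?dh) _")
        using has_vector_derivative_normalized[OF z(1) B, of g g0 c] Dpos FG
        by (simp add: h_def D_def g_def)
      have du: "((\<lambda>t. u (z t)) has_vector_derivative ?v - (y (z s) *\<^sub>R ?dh + (c \<bullet> ?v) *\<^sub>R h (z s))) (at s)"
        unfolding u_def
        by (intro has_vector_derivative_diff z(1) has_vector_derivative_scaleR dy dh)
      have "y (z s) *\<^sub>R ?v = q (z s)"
      proof -
        have "y (z s) * l = min (y (z s)) 0" using l by (cases "y (z s)" "0::real" rule: linorder_cases) auto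
        then show ?thesis by (simp add: q_def scaleR_add_right)
      qed
      then have ydh: "y (z s) *\<^sub>R ?dh = inverse (D (z s)) *\<^sub>R B (q (z s))
          - (inverse (D (z s)) * inverse (D (z s)) * (c \<bullet> B (q (z s)))) *\<^sub>R g (z s)"
      proof -
        have "y (z s) *\<^sub>R B ?v = B (q (z s))"
          using \<open>y (z s) *\<^sub>R ?v = q (z s)\<close> by (metis B.scaleR)
        moreover from this have "y (z s) * (c \<bullet> B ?v) = c \<bullet> B (q (z s))"
          by (metis inner_scaleR_right)
        moreover have "y (z s) *\<^sub>R ?dh = inverse (D (z s)) *\<^sub>R (y (z s) *\<^sub>R B ?v)
            - (inverse (D (z s)) * inverse (D (z s)) * (y (z s) * (c \<bullet> B ?v))) *\<^sub>R g (z s)"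
          by (simp add: scaleR_diff_right mult_ac)
        ultimately show ?thesis by simp
      qed
      \<comment> \<open>Since \<open>c \<bullet> h = 1\<close>, subtracting the
        \<open>c\<close>-component along \<open>h\<close> removes the multiple \<open>l\<close> of
        \<open>g\<close> from the velocity.\<close>
      have vh: "?v - (c \<bullet> ?v) *\<^sub>R h (z s) = G (z s) - (c \<bullet> G (z s)) *\<^sub>R h (z s)"
        using Dpos by (simp add: h_def D_def inner_add_right algebra_simps)
      have "?v - (y (z s) *\<^sub>R ?dh + (c \<bullet> ?v) *\<^sub>R h (z s)) = ?v - (c \<bullet> ?v) *\<^sub>R h (z s) - y (z s) *\<^sub>R ?dh"
        by (simp only: diff_diff_eq add.commute)
      also have "\<dots> = \<Phi> (z s)" unfolding \<Phi>_def ydh vh ..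
      finally show ?thesis using du by simp
    qed
    have w0: "w t = 0"
    proof (rule gronwall_eq_zero[of T w "(M\<Phi> + MG + MD) * C"])
      show "bounded_lipschitz_on {0..T} w"
        unfolding w_def using xl xr0
        by (intro bounded_lipschitz_on_intros bounded_lipschitz_on_compose[OF ul] bounded_lipschitz_on_compose[OF yl])
      show "AE s in lebesgue. 0 < s \<longrightarrow> s < T \<longrightarrow>
        (\<exists>v. (w has_vector_derivative v) (at s) \<and> w s \<bullet> v \<le> ((M\<Phi> + MG + MD) * C) * (w s \<bullet> w s))"
        using ae ae'
      proof eventually_elim
        case (elim s)
        show ?case
        proof (intro impI)
          assume s: "0 < s" "s < T"
          with elim obtain l l' where l: "0 \<le> l" "l \<le> 1"
            "(x has_vector_derivative G (x s) + l *\<^sub>R g (x s)) (at s)"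
            "y (x s) < 0 \<longrightarrow> l = 1" "y (x s) > 0 \<longrightarrow> l = 0"
            and l': "0 \<le> l'" "l' \<le> 1"
            "(x' has_vector_derivative G (x' s) + l' *\<^sub>R g (x' s)) (at s)"
            "y (x' s) < 0 \<longrightarrow> l' = 1" "y (x' s) > 0 \<longrightarrow> l' = 0" by blast
          from s have s': "s \<in> {0..T}" by simp
          then have S: "x s \<in> cball \<xi> r0" "x' s \<in> cball \<xi> r0" using xr0 by blast+
          let ?d = "dist (x s) (x' s)"
          let ?a = "u (x s) - u (x' s)" and ?b = "y (x s) - y (x' s)"
          let ?da = "\<Phi> (x s) - \<Phi> (x' s)"
          let ?db = "c \<bullet> (G (x s) + l *\<^sub>R g (x s)) - c \<bullet> (G (x' s) + l' *\<^sub>R g (x' s))"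
          have "(w has_vector_derivative (?da, ?db)) (at s)"
            unfolding w_def
          proof (intro has_vector_derivative_Pair has_vector_derivative_diff du[OF l(3) S(1) l(4,5)] du[OF l'(3) S(2) l'(4,5)])
            show "((\<lambda>t. y (x t)) has_vector_derivative c \<bullet> (G (x s) + l *\<^sub>R g (x s))) (at s)"
              "((\<lambda>t. y (x' t)) has_vector_derivative c \<bullet> (G (x' s) + l' *\<^sub>R g (x' s))) (at s)"
              using has_real_derivative_affine[OF l(3)] has_real_derivative_affine[OF l'(3)]
              by (auto simp: y_def has_real_derivative_iff_has_vector_derivative)
          qed
          moreover have "w s \<bullet> (?da, ?db) \<le> ((M\<Phi> + MG + MD) * C) * (w s \<bullet> w s)"
          proof -
            have na: "norm ?a \<le> norm (w s)" and nb: "\<bar>?b\<bar> \<le> norm (w s)"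
              unfolding w_def using norm_fst_le norm_snd_le[of ?b ?a] by auto
            have "?a \<bullet> ?da \<le> norm ?a * norm ?da" by (rule norm_cauchy_schwarz)
            also have "\<dots> \<le> norm (w s) * (M\<Phi> * ?d)"
              using na M\<Phi>(2)[OF S] by (intro mult_mono) auto
            finally have 1: "?a \<bullet> ?da \<le> norm (w s) * (M\<Phi> * ?d)" .
            \<comment> \<open>If \<open>y (x s) < y (x' s)\<close>, then either the first value is
              negative and \<open>l = 1\<close>, or the second is positive and
              \<open>l' = 0\<close>; both give \<open>l' \<le> l\<close>. The reverse inequality is
              symmetric.\<close>
            have mono: "?b * ((l - l') * D (x s)) \<le> 0"
            proof -
              have "?b * (l - l') \<le> 0"
              proof (cases "y (x s)" "y (x' s)" rule: linorder_cases)
                case less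
                then have "l - l' \<ge> 0" using l l' by (cases "y (x s) < 0") auto
                then show ?thesis using less by (intro mult_nonpos_nonneg) auto
              next
                case greater
                then have "l - l' \<le> 0" using l l' by (cases "y (x s) > 0") auto
                then show ?thesis using greater by (intro mult_nonneg_nonpos) auto
              qed simp
              moreover have "D (x s) \<ge> 0" using D\<delta>[OF S(1)] r0(3) by simp
              ultimately have "(?b * (l - l')) * D (x s) \<le> 0" by (rule mult_nonpos_nonneg)
              then show ?thesis by (simp add: mult.assoc)
            qed
            \<comment> \<open>With the favourable term \<open>(l - l') * D (x s)\<close> isolated,
              only differences of Lipschitz functions remain, the last with a factor
              \<open>l'\<close> in the unit interval.\<close>
            have "?db = (c \<bullet> G (x s) - c \<bullet> G (x' s)) + (l - l') * D (x s) + l' * (D (x s) - D (x' s))"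
              by (simp add: D_def inner_add_right algebra_simps)
            then have "?b * ?db = ?b * (c \<bullet> G (x s) - c \<bullet> G (x' s)) + ?b * ((l - l') * D (x s)) + ?b * (l' * (D (x s) - D (x' s)))"
              by (simp only: distrib_left)
            moreover have "?b * (c \<bullet> G (x s) - c \<bullet> G (x' s)) \<le> norm (w s) * (MG * ?d)"
            proof -
              have "?b * (c \<bullet> G (x s) - c \<bullet> G (x' s)) \<le> \<bar>?b\<bar> * \<bar>c \<bullet> G (x s) - c \<bullet> G (x' s)\<bar>"
                unfolding abs_mult[symmetric] by (rule abs_ge_self)
              also have "\<dots> \<le> norm (w s) * (MG * ?d)"
                using nb MG(2)[OF S] by (intro mult_mono) auto
              finally show ?thesis .
            qed
            moreover have "?b * (l' * (D (x s) - D (x' s))) \<le> norm (w s) * (MD * ?d)"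
            proof -
              have "?b * (l' * (D (x s) - D (x' s))) \<le> \<bar>?b\<bar> * \<bar>l' * (D (x s) - D (x' s))\<bar>"
                unfolding abs_mult[symmetric] by (rule abs_ge_self)
              also have "\<bar>l' * (D (x s) - D (x' s))\<bar> \<le> 1 * (MD * ?d)"
                unfolding abs_mult using l'(1,2) MD(2)[OF S] by (intro mult_mono) auto
              then have "\<bar>?b\<bar> * \<bar>l' * (D (x s) - D (x' s))\<bar> \<le> norm (w s) * (MD * ?d)"
                using nb by (intro mult_mono) auto
              finally show ?thesis .
            qed
            ultimately have 2: "?b * ?db \<le> norm (w s) * (MG * ?d) + norm (w s) * (MD * ?d)"
              using mono by linarith
            have "w s \<bullet> (?da, ?db) = ?a \<bullet> ?da + ?b * ?db" by (simp add: w_def)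
            also have "\<dots> \<le> norm (w s) * (M\<Phi> * ?d) + (norm (w s) * (MG * ?d) + norm (w s) * (MD * ?d))"
              using 1 2 by (rule add_mono)
            also have "\<dots> = norm (w s) * (M\<Phi> + MG + MD) * ?d" by (simp add: algebra_simps)
            also have "\<dots> \<le> norm (w s) * (M\<Phi> + MG + MD) * (C * norm (w s))"
              using close[OF s'] M\<Phi>(1) MG(1) MD(1) by (intro mult_left_mono) auto
            also have "\<dots> = ((M\<Phi> + MG + MD) * C) * (w s \<bullet> w s)"
              by (simp add: power2_norm_eq_inner[symmetric] power2_eq_square)
            finally show ?thesis .
          qed
          ultimately show "\<exists>v. (w has_vector_derivative v) (at s) \<and> w s \<bullet> v \<le> ((M\<Phi> + MG + MD) * C) * (w s \<bullet> w s)"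
            by blast
        qed
      qed
    qed (use x0 t \<open>C \<ge> 0\<close> M\<Phi>(1) MG(1) MD(1) in \<open>auto simp: w_def zero_prod_def\<close>)
    show "x t = x' t" using close[OF t] w0 by simp
  qed (rule r(1))
qed

section \<open>Second-order sliding\<close>

text \<open>A zero with nonzero derivative is isolated among the zeros, so some member of a
  countable basis meets the set in that point alone; this assignment is injective.\<close>

lemma countable_zeros_nonzero_derivative:
  fixes g :: "real \<Rightarrow> real"
  shows "countable {t. g t = 0 \<and> (\<exists>d. d \<noteq> 0 \<and> (g has_real_derivative d) (at t))}" 
proof -
  define S where "S = {t. g t = 0 \<and> (\<exists>d. d \<noteq> 0 \<and> (g has_real_derivative d) (at t))}"
  obtain \<B> :: "real set set" where \<B>: "countable \<B>" "topological_basis \<B>"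
    using ex_countable_basis by blast
  have "\<exists>b\<in>\<B>. t \<in> b \<and> b \<inter> S = {t}" if "t \<in> S" for t
  proof -
    from that obtain d where d: "d \<noteq> 0" "(g has_real_derivative d) (at t)" and "g t = 0"
      by (auto simp: S_def)
    have "((\<lambda>s. (g s - g t) / (s - t)) \<longlongrightarrow> d) (at t)"
      using d(2) by (simp add: has_field_derivative_iff)
    then have "\<forall>\<^sub>F s in at t. (g s - g t) / (s - t) \<noteq> 0"
      using d(1) by (rule tendsto_imp_eventually_ne)
    then obtain U where U: "open U" "t \<in> U" "\<And>s. s \<in> U \<Longrightarrow> s \<noteq> t \<Longrightarrow> (g s - g t) / (s - t) \<noteq> 0"
      unfolding eventually_at_topological by blast
    obtain b where b: "b \<in> \<B>" "t \<in> b" "b \<subseteq> U"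
      using topological_basisE[OF \<B>(2) U(1,2)] by blast
    have "s = t" if "s \<in> b" "g s = 0" for s
      using U(3)[of s] that b(3) \<open>g t = 0\<close> by auto
    then have "b \<inter> S \<subseteq> {t}" by (intro subsetI) (simp add: S_def)
    then have "b \<inter> S = {t}" using \<open>t \<in> S\<close> b(2) by (intro subset_antisym) simp_all
    with b(1,2) show ?thesis by (intro bexI[of _ b] conjI)
  qed
  then obtain \<beta> where \<beta>: "\<And>t. t \<in> S \<Longrightarrow> \<beta> t \<in> \<B> \<and> \<beta> t \<inter> S = {t}" by metis
  have "inj_on \<beta> S"
  proof (rule inj_onI)
    fix s t assume "s \<in> S" "t \<in> S" "\<beta> s = \<beta> t"
    then have "{s} = {t}" using \<beta>[of s] \<beta>[of t] by metis
    then show "s = t" by simp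
  qed
  moreover have "countable (\<beta> ` S)"
    using \<beta> by (intro countable_subset[OF _ \<B>(1)]) blast
  ultimately have "countable S" by (metis countable_image_inj_on)
  then show ?thesis by (simp add: S_def)
qed

text \<open>Applied to the switching function along a solution: at almost every time spent on the
  surface its derivative vanishes where it exists.\<close>

lemma AE_zero_imp_derivative_zero:
  fixes g :: "real \<Rightarrow> real"
  shows "AE t in lebesgue. g t = 0 \<longrightarrow> (\<forall>d. (g has_real_derivative d) (at t) \<longrightarrow> d = 0)"
proof -
  have "{t. g t = 0 \<and> (\<exists>d. d \<noteq> 0 \<and> (g has_real_derivative d) (at t))} \<in> null_sets lebesgue"
    by (intro null_sets_completionI countable_imp_null_set_lborel countable_zeros_nonzero_derivative)
  then have "AE t in lebesgue. t \<notin> {t. g t = 0 \<and> (\<exists>d. d \<noteq> 0 \<and> (g has_real_derivative d) (at t))}"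
    by (rule AE_not_in)
  then show ?thesis by eventually_elim auto
qed

text \<open>A squeeze of difference quotients. It handles positive and negative parts of a function
  at a zero where its derivative vanishes, so that the kink does no harm.\<close>

lemma has_derivative_zero_dominated:
  fixes g h :: "real \<Rightarrow> real"
  assumes g: "(g has_real_derivative 0) (at t)" and "g t = 0"
    and le: "\<forall>\<^sub>F s in nhds t. \<bar>h s\<bar> \<le> C * \<bar>g s\<bar>"
  shows "(h has_real_derivative 0) (at t)"
proof -
  have "h t = 0" using eventually_nhds_x_imp_x[OF le] \<open>g t = 0\<close> by simp
  have "((\<lambda>s. (g s - g t) / (s - t)) \<longlongrightarrow> 0) (at t)"
    using g by (simp add: has_field_derivative_iff)
  from tendsto_mult[OF tendsto_const[of C] tendsto_rabs[OF this]]
  have lim: "((\<lambda>s. C * \<bar>(g s - g t) / (s - t)\<bar>) \<longlongrightarrow> 0) (at t)" by simp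
  have "((\<lambda>s. (h s - h t) / (s - t)) \<longlongrightarrow> 0) (at t)"
  proof (rule Lim_null_comparison[OF _ lim])
    have "\<forall>\<^sub>F s in at t. \<bar>h s\<bar> \<le> C * \<bar>g s\<bar>"
      using le by (simp add: eventually_at_filter eventually_mono)
    then show "\<forall>\<^sub>F s in at t. norm ((h s - h t) / (s - t)) \<le> C * \<bar>(g s - g t) / (s - t)\<bar>"
      by eventually_elim (simp add: \<open>h t = 0\<close> \<open>g t = 0\<close> abs_divide divide_right_mono)
  qed
  then show ?thesis by (simp add: has_field_derivative_iff)
qed

lemma bounded_lipschitz_on_affine_field:
  fixes L :: "'a::real_normed_vector \<Rightarrow> 'b::real_normed_vector"
  assumes "\<And>x. F x = L x + v" and "bounded_linear L"
  shows "bounded_lipschitz_on (cball \<xi> r) F"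
proof -
  have "bounded_lipschitz_on (cball \<xi> r) (\<lambda>x. L x + v)"
    by (intro bounded_lipschitz_on_intros bounded_lipschitz_on_linear[OF assms(2)] bounded_lipschitz_on_id) simp
  then show ?thesis using assms(1) by presburger
qed

text \<open>
  The sum of \<open>z\<^sup>2 / 2\<close>, where \<open>z = c \<bullet> G x\<close>, and the positive and negative parts of
  \<open>y = c \<bullet> x + f\<close> with weights \<open>- (b \<bullet> G x)\<close> and \<open>(b \<bullet> F x) / \<beta>\<close> is the energy of an oscillator
  \<open>y'' = - sgn y\<close>: the weights cancel the terms of first order in \<open>z\<close>, so that the energy grows
  at most exponentially from 0. Where \<open>y = 0\<close> it need not be differentiable, but there
  \<open>y' = 0\<close> almost everywhere, which forces \<open>z = 0\<close>.
\<close>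

lemma switching_second_order_sliding:
  fixes \<xi> :: "'a::euclidean_space"
  assumes F: "\<And>x. F x = LF x + vF" "bounded_linear LF"
    and G: "\<And>x. G x = LG x + vG" "bounded_linear LG"
    and zero: "c \<bullet> \<xi> + f = 0" "c \<bullet> G \<xi> = 0" and "\<beta> > 0"
    and cG: "\<And>x. c \<bullet> G x = b \<bullet> x + k"
    and cF: "\<And>x. c \<bullet> F x = \<alpha> * (c \<bullet> x + f) + \<beta> * (c \<bullet> G x)"
    and r: "0 < r" "0 < \<delta>" "\<And>x. x \<in> cball \<xi> r \<Longrightarrow> b \<bullet> F x \<ge> \<delta>" "\<And>x. x \<in> cball \<xi> r \<Longrightarrow> - (b \<bullet> G x) \<ge> \<delta>"
    and x: "switching_solution F G c f (cball \<xi> r) T x" "x 0 = \<xi>" and t: "t \<in> {0..T}"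
  shows "c \<bullet> x t + f = 0 \<and> c \<bullet> G (x t) = 0"
proof -
  define y where "y = (\<lambda>x. c \<bullet> x + f)"
  define z where "z = (\<lambda>x. b \<bullet> x + k)"
  define p where "p = (\<lambda>x. b \<bullet> F x)"
  define q where "q = (\<lambda>x. - (b \<bullet> G x))"
  define R where "R = (\<lambda>x. q x * max (y x) 0 + (p x / \<beta>) * max (- y x) 0)"
  define V where "V = (\<lambda>x. z x * z x / 2 + R x)"
  have Fl: "bounded_lipschitz_on (cball \<xi> r) F" and Gl: "bounded_lipschitz_on (cball \<xi> r) G"
    by (rule bounded_lipschitz_on_affine_field[OF F] bounded_lipschitz_on_affine_field[OF G])+
  have yl: "bounded_lipschitz_on (cball \<xi> r) y" and zl: "bounded_lipschitz_on (cball \<xi> r) z"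
    unfolding y_def z_def by (rule bounded_lipschitz_on_affine)+
  have pl: "bounded_lipschitz_on (cball \<xi> r) p" and ql: "bounded_lipschitz_on (cball \<xi> r) q"
    unfolding p_def q_def by (intro bounded_lipschitz_on_intros Fl Gl)+
  have Vl: "bounded_lipschitz_on (cball \<xi> r) V"
    unfolding V_def R_def divide_inverse
    by (intro bounded_lipschitz_on_intros yl zl pl ql)
  obtain N1 where N1: "\<And>x. x \<in> cball \<xi> r \<Longrightarrow> norm (b \<bullet> LF (F x)) \<le> N1"
    using bounded_lipschitz_onE[OF bounded_lipschitz_on_inner[OF bounded_lipschitz_on_const bounded_lipschitz_on_linear[OF F(2) Fl]]] by metis
  obtain N2 where N2: "\<And>x. x \<in> cball \<xi> r \<Longrightarrow> norm (b \<bullet> LG (G x)) \<le> N2"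
    using bounded_lipschitz_onE[OF bounded_lipschitz_on_inner[OF bounded_lipschitz_on_const bounded_lipschitz_on_linear[OF G(2) Gl]]] by metis
  obtain P where P: "P \<ge> 0" "\<And>x. x \<in> cball \<xi> r \<Longrightarrow> norm (p x) \<le> P"
    using bounded_lipschitz_onE[OF pl] by metis
  obtain Q where Q: "Q \<ge> 0" "\<And>x. x \<in> cball \<xi> r \<Longrightarrow> norm (q x) \<le> Q"
    using bounded_lipschitz_onE[OF ql] by metis
  \<comment> \<open>\<open>N1\<close> and \<open>N2\<close> bound the derivatives of
    \<open>p\<close> and \<open>- q\<close> along modes 1 and 2;
    \<open>P * \<bar>\<alpha>\<bar>\<close> accounts for the term \<open>\<alpha> * y\<close> in
    \<open>c \<bullet> F\<close>.\<close>
  define N where "N = max N1 N2 + P * \<bar>\<alpha>\<bar>"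
  have "\<xi> \<in> cball \<xi> r" using r(1) by simp
  from N1[OF this] have "N1 \<ge> 0" using norm_ge_zero order_trans by blast
  then have "N \<ge> 0" using P(1) by (simp add: N_def)
  \<comment> \<open>Coercivity of the energy, used twice: to bound the remainders of order
    \<open>y\<close> by \<open>V\<close>, and to read off \<open>y = 0\<close> and
    \<open>z = 0\<close> from \<open>V \<le> 0\<close>.\<close>
  have V_ge: "V x \<ge> z x * z x / 2 + \<delta> * max (y x) 0 + (\<delta> / \<beta>) * max (- y x) 0" if "x \<in> cball \<xi> r" for x
  proof -
    have "\<delta> * max (y x) 0 \<le> q x * max (y x) 0" using r(4)[OF that] by (intro mult_right_mono) (auto simp: q_def)
    moreover have "(\<delta> / \<beta>) * max (- y x) 0 \<le> (p x / \<beta>) * max (- y x) 0"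
      using r(3)[OF that] \<open>\<beta> > 0\<close> by (intro mult_right_mono divide_right_mono) (auto simp: p_def)
    ultimately show ?thesis by (simp add: V_def R_def)
  qed
  have xl: "bounded_lipschitz_on {0..T} x" and xr: "x ` {0..T} \<subseteq> cball \<xi> r"
    and ae: "AE t in lebesgue. 0 < t \<longrightarrow> t < T \<longrightarrow> (\<exists>l. 0 \<le> l \<and> l \<le> 1 \<and>
       (x has_vector_derivative G (x t) + l *\<^sub>R (F (x t) - G (x t))) (at t) \<and>
       (y (x t) < 0 \<longrightarrow> l = 1) \<and> (y (x t) > 0 \<longrightarrow> l = 0))"
    using x(1) by (simp_all add: switching_solution_def y_def)
  have "V (x t) \<le> 0"
  proof (rule gronwall_le_zero[of T "\<lambda>t. V (x t)" "N / \<delta>"])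
    show "bounded_lipschitz_on {0..T} (\<lambda>t. V (x t))"
      by (rule bounded_lipschitz_on_compose[OF Vl xl xr])
    show "V (x 0) \<le> 0" 
    proof -
      have "y \<xi> = 0" "z \<xi> = 0" using zero cG by (simp_all add: y_def z_def)
      then show ?thesis by (simp add: V_def R_def x(2))
    qed
    show "AE s in lebesgue. 0 < s \<longrightarrow> s < T \<longrightarrow> (\<exists>d. ((\<lambda>t. V (x t)) has_real_derivative d) (at s) \<and> d \<le> N / \<delta> * V (x s))"
      using ae AE_zero_imp_derivative_zero[of "\<lambda>t. y (x t)"]
    proof eventually_elim
      case (elim s)
      show ?case
      proof (intro impI)
        assume s: "0 < s" "s < T"
        with elim obtain l where l: "0 \<le> l" "l \<le> 1"
          "(x has_vector_derivative G (x s) + l *\<^sub>R (F (x s) - G (x s))) (at s)"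
          "y (x s) < 0 \<longrightarrow> l = 1" "y (x s) > 0 \<longrightarrow> l = 0" by blast
        let ?v = "G (x s) + l *\<^sub>R (F (x s) - G (x s))"
        have S: "x s \<in> cball \<xi> r" using xr s by (simp add: image_subset_iff del: mem_cball)
        have dy: "((\<lambda>t. y (x t)) has_real_derivative c \<bullet> ?v) (at s)"
          and dz: "((\<lambda>t. z (x t)) has_real_derivative b \<bullet> ?v) (at s)"
          unfolding y_def z_def by (rule has_real_derivative_affine[OF l(3)])+
        have cont: "((\<lambda>t. y (x t)) \<longlongrightarrow> y (x s)) (nhds s)"
          using DERIV_isCont[OF dy] tendsto_at_iff_tendsto_nhds[of "\<lambda>t. y (x t)" s] by (simp add: isCont_def)
        consider "y (x s) > 0" | "y (x s) < 0" | "y (x s) = 0" by linarith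
        then show "\<exists>d. ((\<lambda>t. V (x t)) has_real_derivative d) (at s) \<and> d \<le> N / \<delta> * V (x s)"
        proof cases
          case 1
          then have v: "?v = G (x s)" using l(5) by simp
          have dq: "((\<lambda>t. q (x t)) has_real_derivative - (b \<bullet> LG (G (x s)))) (at s)"
          proof -
            have "((\<lambda>t. LG (x t)) has_vector_derivative LG (G (x s))) (at s)"
              using bounded_linear.has_vector_derivative[OF G(2) l(3)] v by simp
            from has_real_derivative_affine[OF this, of b "b \<bullet> vG"] show ?thesis
              unfolding q_def G(1) inner_add_right by (rule DERIV_minus)
          qed
          \<comment> \<open>In mode 2, \<open>z' = - q\<close> and \<open>y' = z\<close>, so
            \<open>z * z'\<close> and \<open>q * y'\<close> cancel and only \<open>q' * y\<close>
            remains.\<close>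
          have "((\<lambda>t. z (x t) * z (x t) / 2 + q (x t) * y (x t)) has_real_derivative
              - (b \<bullet> LG (G (x s))) * y (x s)) (at s)"
          proof -
            have "((\<lambda>t. y (x t)) has_real_derivative z (x s)) (at s)"
              using dy unfolding v by (simp add: cG z_def)
            moreover have "((\<lambda>t. z (x t)) has_real_derivative - q (x s)) (at s)"
              using dz unfolding v by (simp add: q_def)
            ultimately show ?thesis
              using dq by (auto intro!: derivative_eq_intros simp: field_simps)
          qed
          moreover have "\<forall>\<^sub>F t in nhds s. z (x t) * z (x t) / 2 + q (x t) * y (x t) = V (x t)"
          proof -
            have "\<forall>\<^sub>F t in nhds s. y (x t) > 0"
              using cont 1 by (rule order_tendstoD(1))
            then show ?thesis by eventually_elim (simp add: V_def R_def)
          qed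
          ultimately have dV: "((\<lambda>t. V (x t)) has_real_derivative - (b \<bullet> LG (G (x s))) * y (x s)) (at s)"
            by (subst (asm) DERIV_cong_ev[OF refl _ refl]) auto
          have "- (b \<bullet> LG (G (x s))) * y (x s) \<le> N * y (x s)"
            using N2[OF S] 1 P(1) by (intro mult_right_mono) (auto simp: N_def add_increasing2)
          also have "\<dots> = N / \<delta> * (\<delta> * y (x s))" using r(2) by simp
          also have "\<dots> \<le> N / \<delta> * V (x s)"
            using V_ge[OF S] 1 r(2) \<open>N \<ge> 0\<close> by (intro mult_left_mono) (auto intro: order_trans[rotated])
          finally show ?thesis using dV by blast
        next
          case 2
          then have v: "?v = F (x s)" using l(4) by simp
          have dp: "((\<lambda>t. p (x t)) has_real_derivative b \<bullet> LF (F (x s))) (at s)"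
          proof -
            have "((\<lambda>t. LF (x t)) has_vector_derivative LF (F (x s))) (at s)"
              using bounded_linear.has_vector_derivative[OF F(2) l(3)] v by simp
            from has_real_derivative_affine[OF this, of b "b \<bullet> vF"] show ?thesis
              unfolding p_def F(1) inner_add_right .
          qed
          let ?d = "(b \<bullet> LF (F (x s)) + p (x s) * \<alpha>) / \<beta> * (- y (x s))"
          \<comment> \<open>In mode 1, \<open>z' = p\<close> and
            \<open>y' = \<alpha> * y + \<beta> * z\<close>. The weight \<open>p / \<beta>\<close> is
            what cancels the terms in \<open>p * z\<close>.\<close>
          have "((\<lambda>t. z (x t) * z (x t) / 2 + p (x t) / \<beta> * (- y (x t))) has_real_derivative ?d) (at s)"
          proof -
            have "((\<lambda>t. y (x t)) has_real_derivative \<alpha> * y (x s) + \<beta> * z (x s)) (at s)"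
              using dy unfolding v by (simp add: cF cG z_def y_def)
            moreover have "((\<lambda>t. z (x t)) has_real_derivative p (x s)) (at s)"
              using dz unfolding v by (simp add: p_def)
            ultimately show ?thesis
              using dp \<open>\<beta> > 0\<close> by (auto intro!: derivative_eq_intros simp: field_simps)
          qed
          moreover have "\<forall>\<^sub>F t in nhds s. z (x t) * z (x t) / 2 + p (x t) / \<beta> * (- y (x t)) = V (x t)"
          proof -
            have "\<forall>\<^sub>F t in nhds s. y (x t) < 0"
              using cont 2 by (rule order_tendstoD(2))
            then show ?thesis by eventually_elim (simp add: V_def R_def)
          qed
          ultimately have dV: "((\<lambda>t. V (x t)) has_real_derivative ?d) (at s)"
            by (subst (asm) DERIV_cong_ev[OF refl _ refl]) auto
          have "b \<bullet> LF (F (x s)) + p (x s) * \<alpha> \<le> N"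
          proof -
            have "p (x s) * \<alpha> \<le> P * \<bar>\<alpha>\<bar>"
              using mult_mono[OF P(2)[OF S] order_refl, of "\<bar>\<alpha>\<bar>"] P(1) abs_ge_self[of "p (x s) * \<alpha>"]
              by (simp add: abs_mult)
            then show ?thesis using N1[OF S] by (simp add: N_def)
          qed
          then have "?d \<le> N / \<beta> * (- y (x s))"
            using 2 \<open>\<beta> > 0\<close> by (intro mult_right_mono divide_right_mono) auto
          also have "\<dots> = N / \<delta> * (\<delta> / \<beta> * (- y (x s)))" using r(2) by simp
          also have "\<dots> \<le> N / \<delta> * V (x s)"
            using V_ge[OF S] 2 r(2) \<open>N \<ge> 0\<close> by (intro mult_left_mono) (auto intro: order_trans[rotated])
          finally show ?thesis using dV by blast
        next
          case 3
          then have dy0: "c \<bullet> ?v = 0" using elim dy by blast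
          \<comment> \<open>On the surface both modes move \<open>y\<close> at a positive multiple
            of \<open>z\<close>, hence so does every mixture, and \<open>y' = 0\<close> forces
            \<open>z = 0\<close>.\<close>
          have "c \<bullet> ?v = ((1 - l) + l * \<beta>) * z (x s)"
          proof -
            have "c \<bullet> F (x s) = \<beta> * z (x s)" "c \<bullet> G (x s) = z (x s)"
              using 3 by (simp_all add: cF cG y_def z_def)
            then show ?thesis by (simp add: inner_add_right inner_diff_right algebra_simps)
          qed
          moreover have "(1 - l) + l * \<beta> > 0"
            using l(1,2) \<open>\<beta> > 0\<close> by (cases "l = 0") (auto intro: add_nonneg_pos)
          ultimately have z0: "z (x s) = 0" using dy0 by simp
          \<comment> \<open>\<open>R\<close> is dominated by a multiple of
            \<open>\<bar>y\<bar>\<close>, and \<open>y\<close> vanishes at \<open>s\<close> together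
            with its derivative.\<close>
          have "((\<lambda>t. R (x t)) has_real_derivative 0) (at s)"
          proof (rule has_derivative_zero_dominated[of "\<lambda>t. y (x t)" _ _ "Q + P / \<beta>"])
            show "((\<lambda>t. y (x t)) has_real_derivative 0) (at s)" using dy dy0 by simp
            show "y (x s) = 0" by fact
            have "\<forall>\<^sub>F t in nhds s. t \<in> {0<..<T}" using s by (intro eventually_nhds_in_open) auto
            then show "\<forall>\<^sub>F t in nhds s. \<bar>R (x t)\<bar> \<le> (Q + P / \<beta>) * \<bar>y (x t)\<bar>"
            proof eventually_elim
              case (elim t)
              then have S: "x t \<in> cball \<xi> r" using xr by (simp add: image_subset_iff del: mem_cball)
              have "\<bar>R (x t)\<bar> \<le> \<bar>q (x t)\<bar> * max (y (x t)) 0 + \<bar>p (x t)\<bar> / \<beta> * max (- y (x t)) 0"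
                unfolding R_def using \<open>\<beta> > 0\<close> by (intro abs_triangle_ineq[THEN order_trans]) (simp add: abs_mult)
              also have "\<dots> \<le> Q * \<bar>y (x t)\<bar> + P / \<beta> * \<bar>y (x t)\<bar>"
                using P Q S \<open>\<beta> > 0\<close> by (intro add_mono mult_mono divide_right_mono) auto
              finally show ?case by (simp add: distrib_right)
            qed
          qed
          then have "((\<lambda>t. V (x t)) has_real_derivative 0) (at s)"
            unfolding V_def by (auto intro!: derivative_eq_intros dz simp: z0)
          moreover have "V (x s) = 0" using 3 z0 by (simp add: V_def R_def)
          ultimately show ?thesis by force
        qed
      qed
    qed
  qed (use t r(2) \<open>N \<ge> 0\<close> in auto)
  moreover have "x t \<in> cball \<xi> r" using xr t by (simp add: image_subset_iff del: mem_cball)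
  ultimately have le: "z (x t) * z (x t) / 2 + \<delta> * max (y (x t)) 0 + (\<delta> / \<beta>) * max (- y (x t)) 0 \<le> 0"
    using V_ge by force
  have nn: "z (x t) * z (x t) \<ge> 0" "\<delta> * max (y (x t)) 0 \<ge> 0" "(\<delta> / \<beta>) * max (- y (x t)) 0 \<ge> 0"
    using r(2) \<open>\<beta> > 0\<close> by auto
  then have "z (x t) * z (x t) = 0" "\<delta> * max (y (x t)) 0 = 0" "(\<delta> / \<beta>) * max (- y (x t)) 0 = 0"
    using le by linarith+
  then have "z (x t) = 0" "max (y (x t)) 0 = 0" "max (- y (x t)) 0 = 0"
    using r(2) \<open>\<beta> > 0\<close> by auto
  then show ?thesis using cG by (auto simp: y_def z_def max_def split: if_splits)
qed

text \<open>Every solution keeps \<open>b \<bullet> x + k\<close> at 0. Differentiating this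
  identity determines \<open>l\<close> as the quotient of \<open>- (b \<bullet> G)\<close> by
  \<open>b \<bullet> F - b \<bullet> G\<close>, and inserting it yields one Lipschitz sliding field
  \<open>\<Phi>\<close> for all solutions.\<close>

lemma switching_unique_second_order_sliding:
  fixes \<xi> :: "'a::euclidean_space"
  assumes F: "\<And>x. F x = LF x + vF" "bounded_linear LF"
    and G: "\<And>x. G x = LG x + vG" "bounded_linear LG"
    and zero: "c \<bullet> \<xi> + f = 0" "c \<bullet> G \<xi> = 0" and "\<beta> > 0"
    and cG: "\<And>x. c \<bullet> G x = b \<bullet> x + k"
    and cF: "\<And>x. c \<bullet> F x = \<alpha> * (c \<bullet> x + f) + \<beta> * (c \<bullet> G x)"
    and sgn: "b \<bullet> F \<xi> > 0" "b \<bullet> G \<xi> < 0"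
  shows "switching_unique F G c f \<xi>"
proof -
  have Fl: "bounded_lipschitz_on (cball \<xi> r) F" and Gl: "bounded_lipschitz_on (cball \<xi> r) G" for r
    by (rule bounded_lipschitz_on_affine_field[OF F] bounded_lipschitz_on_affine_field[OF G])+
  let ?m = "\<lambda>x. min (b \<bullet> F x) (- (b \<bullet> G x))"
  have "bounded_lipschitz_on (cball \<xi> 1) ?m" by (intro bounded_lipschitz_on_intros Fl Gl)
  moreover have "?m \<xi> > 0" using sgn by simp
  ultimately obtain r \<delta> where r: "0 < r" "0 < \<delta>" and m: "\<And>x. x \<in> cball \<xi> r \<Longrightarrow> ?m x \<ge> \<delta>"
    by (rule positive_near) blast
  define \<Phi> where "\<Phi> = (\<lambda>x. G x + (- (b \<bullet> G x) * inverse (b \<bullet> F x - b \<bullet> G x)) *\<^sub>R (F x - G x))"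
  have inv: "bounded_lipschitz_on (cball \<xi> r) (\<lambda>x. inverse (b \<bullet> F x - b \<bullet> G x))"
  proof (rule bounded_lipschitz_on_inverse)
    show "bounded_lipschitz_on (cball \<xi> r) (\<lambda>x. b \<bullet> F x - b \<bullet> G x)"
      by (intro bounded_lipschitz_on_intros Fl Gl)
    show "b \<bullet> F x - b \<bullet> G x \<ge> \<delta>" if "x \<in> cball \<xi> r" for x using m[OF that] r(2) by auto
  qed fact
  have \<Phi>l: "bounded_lipschitz_on (cball \<xi> r) \<Phi>"
    unfolding \<Phi>_def by (intro bounded_lipschitz_on_intros inv Fl Gl)
  show ?thesis
    unfolding switching_unique_def
  proof (intro exI[of _ r] conjI allI impI ballI)
    fix T x x' t
    assume x: "switching_solution F G c f (cball \<xi> r) T x" "switching_solution F G c f (cball \<xi> r) T x'"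
      and x0: "x 0 = \<xi>" "x' 0 = \<xi>" and t: "t \<in> {0..T}"
    have *: "AE t in lebesgue. 0 < t \<longrightarrow> t < T \<longrightarrow> (w has_vector_derivative \<Phi> (w t)) (at t)"
      if w: "switching_solution F G c f (cball \<xi> r) T w" "w 0 = \<xi>" for w
    proof -
      have wr: "w ` {0..T} \<subseteq> cball \<xi> r"
        and ae: "AE t in lebesgue. 0 < t \<longrightarrow> t < T \<longrightarrow> (\<exists>l. 0 \<le> l \<and> l \<le> 1 \<and>
           (w has_vector_derivative G (w t) + l *\<^sub>R (F (w t) - G (w t))) (at t) \<and>
           (c \<bullet> w t + f < 0 \<longrightarrow> l = 1) \<and> (c \<bullet> w t + f > 0 \<longrightarrow> l = 0))"
        using w(1) by (simp_all add: switching_solution_def)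
      from ae show ?thesis
      proof eventually_elim
        case (elim t)
        show ?case
        proof (intro impI)
          assume t: "0 < t" "t < T"
          with elim obtain l where l: "(w has_vector_derivative G (w t) + l *\<^sub>R (F (w t) - G (w t))) (at t)" by blast
          have S: "w t \<in> cball \<xi> r" using wr t by (simp add: image_subset_iff del: mem_cball)
          have d1: "((\<lambda>t. b \<bullet> w t + k) has_real_derivative b \<bullet> (G (w t) + l *\<^sub>R (F (w t) - G (w t)))) (at t)"
            by (rule has_real_derivative_affine[OF l])
          \<comment> \<open>The constraint holds on a whole neighbourhood of \<open>t\<close>, so
            its derivative at \<open>t\<close> is 0.\<close>
          have "\<forall>\<^sub>F s in nhds t. s \<in> {0<..<T}" using t by (intro eventually_nhds_in_open) auto
          then have "\<forall>\<^sub>F s in nhds t. b \<bullet> w s + k = 0"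
          proof eventually_elim
            case (elim s)
            then have "s \<in> {0..T}" by simp
            from switching_second_order_sliding[OF F G zero \<open>\<beta> > 0\<close> cG cF r _ _ w this] m
            have "c \<bullet> G (w s) = 0" by fastforce
            then show ?case by (simp add: cG)
          qed
          then have "((\<lambda>t. b \<bullet> w t + k) has_real_derivative 0) (at t)"
            by (subst DERIV_cong_ev[OF refl _ refl]) auto
          with d1 have "b \<bullet> (G (w t) + l *\<^sub>R (F (w t) - G (w t))) = 0" by (rule DERIV_unique)
          then have "l * (b \<bullet> F (w t) - b \<bullet> G (w t)) = - (b \<bullet> G (w t))"
            by (simp add: inner_add_right inner_diff_right)
          moreover have "b \<bullet> F (w t) - b \<bullet> G (w t) > 0" using m[OF S] r(2) by auto
          ultimately have "l = - (b \<bullet> G (w t)) * inverse (b \<bullet> F (w t) - b \<bullet> G (w t))"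
            by (simp add: field_simps)
          then show "(w has_vector_derivative \<Phi> (w t)) (at t)" using l by (simp add: \<Phi>_def)
        qed
      qed
    qed
    show "x t = x' t"
      using *[OF x(1) x0(1)] *[OF x(2) x0(2)] x x0 t
      by (intro lipschitz_ode_unique[OF _ _ _ _ \<Phi>l, of T x x' t]) (auto simp: switching_solution_def)
  qed (fact r(1))
qed

section \<open>Bimodal piecewise affine systems\<close>

lemma switching_solution_subinterval:
  assumes "switching_solution F G c f S T x" "T' \<le> T"
  shows "switching_solution F G c f S T' x"
  unfolding switching_solution_def
proof (intro conjI)
  have x: "bounded_lipschitz_on {0..T} x" "x ` {0..T} \<subseteq> S"
    and ae: "AE t in lebesgue. 0 < t \<longrightarrow> t < T \<longrightarrow> (\<exists>l. 0 \<le> l \<and> l \<le> 1 \<and>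
       (x has_vector_derivative G (x t) + l *\<^sub>R (F (x t) - G (x t))) (at t) \<and>
       (c \<bullet> x t + f < 0 \<longrightarrow> l = 1) \<and> (c \<bullet> x t + f > 0 \<longrightarrow> l = 0))"
    using assms(1) by (simp_all add: switching_solution_def)
  show "bounded_lipschitz_on {0..T'} x"
    using x(1) assms(2) by (auto intro: bounded_lipschitz_on_subset)
  show "x ` {0..T'} \<subseteq> S" using x(2) assms(2) by (meson atLeastatMost_subset_iff image_mono order_refl order_trans)
  show "AE t in lebesgue. 0 < t \<longrightarrow> t < T' \<longrightarrow> (\<exists>l. 0 \<le> l \<and> l \<le> 1 \<and>
       (x has_vector_derivative G (x t) + l *\<^sub>R (F (x t) - G (x t))) (at t) \<and>
       (c \<bullet> x t + f < 0 \<longrightarrow> l = 1) \<and> (c \<bullet> x t + f > 0 \<longrightarrow> l = 0))"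
    using ae by eventually_elim (use assms(2) in auto)
qed

lemma filippov_map_convex_combination:
  assumes "v \<in> filippov_map A e c f x"
  obtains l where "0 \<le> l" "l \<le> 1"
    "v = (A 2 *v x + e 2) + l *\<^sub>R ((A 1 *v x + e 1) - (A 2 *v x + e 2))"
    "c \<bullet> x + f < 0 \<longrightarrow> l = 1" "c \<bullet> x + f > 0 \<longrightarrow> l = 0"
proof (cases "c \<bullet> x + f" "0::real" rule: linorder_cases)
  case less
  with assms that[of 1] show thesis by (simp add: filippov_map_def)
next
  case greater
  with assms that[of 0] show thesis by (simp add: filippov_map_def)
next
  case equal
  with assms obtain a b where ab: "0 \<le> a" "0 \<le> b" "a + b = 1" "v = a *\<^sub>R (A 1 *v x + e 1) + b *\<^sub>R (A 2 *v x + e 2)"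
    unfolding filippov_map_def convex_hull_2 by auto
  then have "b = 1 - a" by simp
  with ab that[of a] equal show thesis by (simp add: algebra_simps)
qed

text \<open>Continuity keeps the solution in the ball on a short interval; there both fields are
  bounded, so the bounded-derivative lemma upgrades absolute continuity to a Lipschitz
  bound.\<close>

lemma filippov_imp_switching_solution:
  assumes x: "filippov_solution A e c f \<xi> x" and "r > 0"
  shows "\<exists>T>0. switching_solution (\<lambda>x. A 1 *v x + e 1) (\<lambda>x. A 2 *v x + e 2) c f (cball \<xi> r) T x"
proof -
  let ?F = "\<lambda>x. A 1 *v x + e 1" and ?G = "\<lambda>x. A 2 *v x + e 2"
  have ac: "abs_continuous_on_interval a b x" for a b
    using x by (simp add: filippov_solution_def)
  have x0: "x 0 = \<xi>"
    and ae: "AE t in lebesgue. \<exists>v \<in> filippov_map A e c f (x t). (x has_vector_derivative v) (at t)"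
    using x by (auto simp: filippov_solution_def)
  have ae': "AE t in lebesgue. \<exists>l. 0 \<le> l \<and> l \<le> 1 \<and>
       (x has_vector_derivative ?G (x t) + l *\<^sub>R (?F (x t) - ?G (x t))) (at t) \<and>
       (c \<bullet> x t + f < 0 \<longrightarrow> l = 1) \<and> (c \<bullet> x t + f > 0 \<longrightarrow> l = 0)"
    using ae
  proof eventually_elim
    case (elim t)
    then obtain v where v: "v \<in> filippov_map A e c f (x t)" "(x has_vector_derivative v) (at t)" by blast
    from filippov_map_convex_combination[OF v(1)] v(2) show ?case by metis
  qed
  have "continuous_on {-1..1} x" using ac by (rule abs_continuous_on_interval_imp_continuous_on)
  then have "isCont x 0" by (rule continuous_on_interior) (simp add: interior_atLeastAtMost_real)
  then obtain d where d: "d > 0" "\<And>t. dist t 0 < d \<Longrightarrow> dist (x t) (x 0) < r"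
    using \<open>r > 0\<close> unfolding continuous_at_eps_delta by blast
  \<comment> \<open>Half of \<open>d\<close>, so that the closed interval \<open>{0..T}\<close> lies
    in the open neighbourhood where the estimate holds.\<close>
  define T where "T = d / 2"
  have T: "T > 0" using d(1) by (simp add: T_def)
  have xr: "x t \<in> cball \<xi> r" if "t \<in> {0..T}" for t
    using d(2)[of t] that d(1) x0 by (auto simp: T_def dist_commute)
  have Fl: "bounded_lipschitz_on (cball \<xi> r) (\<lambda>x. A i *v x + e i)" for i
    by (rule bounded_lipschitz_on_affine_field[OF _ matrix_vector_mul_bounded_linear]) simp
  obtain B1 where B1: "B1 \<ge> 0" "\<And>x. x \<in> cball \<xi> r \<Longrightarrow> norm (?F x) \<le> B1"
    using bounded_lipschitz_onE[OF Fl[of 1]] by metis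
  obtain B2 where B2: "B2 \<ge> 0" "\<And>x. x \<in> cball \<xi> r \<Longrightarrow> norm (?G x) \<le> B2"
    using bounded_lipschitz_onE[OF Fl[of 2]] by metis
  have lip: "(B1 + B2)-lipschitz_on {0..T} x"
  proof (rule abs_continuous_bounded_derivative_imp_lipschitz[OF ac])
    show "AE t in lebesgue. 0 < t \<longrightarrow> t < T \<longrightarrow> (\<exists>v. (x has_vector_derivative v) (at t) \<and> norm v \<le> B1 + B2)"
      using ae'
    proof eventually_elim
      case (elim t)
      show ?case
      proof (intro impI)
        assume t: "0 < t" "t < T"
        from elim obtain l where l: "0 \<le> l" "l \<le> 1"
          "(x has_vector_derivative ?G (x t) + l *\<^sub>R (?F (x t) - ?G (x t))) (at t)" by blast
        have S: "x t \<in> cball \<xi> r" using xr t by simp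
        have eq: "?G (x t) + l *\<^sub>R (?F (x t) - ?G (x t)) = (1 - l) *\<^sub>R ?G (x t) + l *\<^sub>R ?F (x t)"
          by (simp add: algebra_simps)
        have "norm ((1 - l) *\<^sub>R ?G (x t)) \<le> 1 * B2" "norm (l *\<^sub>R ?F (x t)) \<le> 1 * B1"
          unfolding norm_scaleR using l B1(2)[OF S] B2(2)[OF S] by (intro mult_mono; simp)+
        then have "norm (?G (x t) + l *\<^sub>R (?F (x t) - ?G (x t))) \<le> B1 + B2"
          unfolding eq by (intro norm_triangle_le) simp
        with l(3) show "\<exists>v. (x has_vector_derivative v) (at t) \<and> norm v \<le> B1 + B2" by blast
      qed
    qed
  qed (use B1(1) B2(1) in simp)
  have "bounded_lipschitz_on {0..T} x"
  proof (rule bounded_lipschitz_onI)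
    show "norm (x t) \<le> norm \<xi> + r" if "t \<in> {0..T}" for t
      using xr[OF that] norm_triangle_sub[of "x t" \<xi>] by (simp add: dist_norm norm_minus_commute)
    show "norm (x s - x t) \<le> (B1 + B2) * dist s t" if "s \<in> {0..T}" "t \<in> {0..T}" for s t
      using lipschitz_onD[OF lip that] by (simp add: dist_norm)
  qed
  moreover have "AE t in lebesgue. 0 < t \<longrightarrow> t < T \<longrightarrow> (\<exists>l. 0 \<le> l \<and> l \<le> 1 \<and>
       (x has_vector_derivative ?G (x t) + l *\<^sub>R (?F (x t) - ?G (x t))) (at t) \<and>
       (c \<bullet> x t + f < 0 \<longrightarrow> l = 1) \<and> (c \<bullet> x t + f > 0 \<longrightarrow> l = 0))"
    using ae' by eventually_elim blast
  ultimately show ?thesis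
    using T xr unfolding switching_solution_def by (intro exI[of _ T]) blast
qed

lemma switching_unique_imp_right_unique:
  assumes "switching_unique (\<lambda>x. A 1 *v x + e 1) (\<lambda>x. A 2 *v x + e 2) c f \<xi>"
    and x: "filippov_solution A e c f \<xi> x"
  shows "right_unique_solution A e c f \<xi> x"
  unfolding right_unique_solution_def
proof (intro allI impI)
  let ?F = "\<lambda>x. A 1 *v x + e 1" and ?G = "\<lambda>x. A 2 *v x + e 2"
  fix x' assume x': "filippov_solution A e c f \<xi> x'"
  obtain r where "r > 0" and r: "\<And>T x x'. switching_solution ?F ?G c f (cball \<xi> r) T x \<Longrightarrow>
       switching_solution ?F ?G c f (cball \<xi> r) T x' \<Longrightarrow> x 0 = \<xi> \<Longrightarrow> x' 0 = \<xi> \<Longrightarrow> \<forall>t\<in>{0..T}. x t = x' t"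
    using assms(1) unfolding switching_unique_def by blast
  obtain T1 T2 where T: "T1 > 0" "switching_solution ?F ?G c f (cball \<xi> r) T1 x"
    "T2 > 0" "switching_solution ?F ?G c f (cball \<xi> r) T2 x'"
    using filippov_imp_switching_solution[OF x \<open>r > 0\<close>] filippov_imp_switching_solution[OF x' \<open>r > 0\<close>] by blast
  have "\<forall>t\<in>{0..min T1 T2}. x t = x' t"
    using x x' by (intro r switching_solution_subinterval[OF T(2)] switching_solution_subinterval[OF T(4)])
      (auto simp: filippov_solution_def)
  then show "\<exists>\<epsilon>>0. \<forall>t\<in>{0..<\<epsilon>}. x t = x' t"
    using T(1,3) by (intro exI[of _ "min T1 T2"]) auto
qed

section \<open>The matrix hypotheses and the final case distinction\<close>

lemma matrix_matrix_mult_row_3: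
  fixes M :: "real ^ 3 ^ 3" and L :: "real ^ 'n ^ 3"
  shows "(M ** L) $ i = M $ i $ 1 *\<^sub>R L $ 1 + M $ i $ 2 *\<^sub>R L $ 2 + M $ i $ 3 *\<^sub>R L $ 3"
  by (simp add: vec_eq_iff matrix_matrix_mult_def sum_3)

lemma linear_stack_nth [simp]:
  "linear_stack c A $ 1 = c" "linear_stack c A $ 2 = c v* A" "linear_stack c A $ 3 = c v* (A ** A)"
  by (simp_all add: linear_stack_def)

lemma constant_stack_nth [simp]:
  "constant_stack c f A e $ 1 = f" "constant_stack c f A e $ 2 = c \<bullet> e" "constant_stack c f A e $ 3 = (c v* A) \<bullet> e"
  by (simp_all add: constant_stack_def)

text \<open>Reads the third row of the stacks as the derivative of
  \<open>(c v* A) \<bullet> x\<close> along the field \<open>A *v x + e\<close>, that is, as a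
  second derivative of the switching function.\<close>

lemma vector_matrix_square_inner:
  fixes A :: "real ^ 'n ^ 'n"
  shows "(c v* (A ** A)) \<bullet> x + (c v* A) \<bullet> e = (c v* A) \<bullet> (A *v x + e)"
  by (simp add: dot_lmul_matrix inner_add_right flip: matrix_vector_mul_assoc)

text \<open>Membership in the exceptional set in terms of successive derivatives: the switching
  function and its first two derivatives vanish along mode \<open>j\<close>, while the second
  derivative along mode \<open>k\<close> points away from the side where mode \<open>k\<close> is
  active.\<close>

lemma exceptional_statesI:
  fixes A :: "nat \<Rightarrow> real ^ 'n ^ 'n"
  assumes "k \<in> {1, 2}" "j \<in> {1, 2}" "k \<noteq> j"
    and "c \<bullet> \<xi> + f = 0" "c \<bullet> (A j *v \<xi> + e j) = 0" "(c v* A j) \<bullet> (A j *v \<xi> + e j) = 0"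
    and "(- 1) ^ k * ((c v* A k) \<bullet> (A k *v \<xi> + e k)) < 0"
  shows "\<xi> \<in> exceptional_states A e c f"
  unfolding exceptional_states_def mem_Collect_eq
proof (rule bexI[of _ k], rule bexI[of _ j], intro conjI)
  show "linear_stack c (A j) *v \<xi> + constant_stack c f (A j) (e j) = 0"
    using assms(4-6)
    by (simp add: vec_eq_iff forall_3 matrix_vector_mul_component vector_matrix_square_inner dot_lmul_matrix inner_add_right flip: matrix_vector_mul_assoc)
qed (use assms in \<open>auto simp: vector_matrix_square_inner\<close>)

lemma lex_greater_cases:
  assumes "v \<succ> w"
  obtains "v $ 1 > w $ 1" | "v $ 1 = w $ 1" "v $ 2 > w $ 2" | "v $ 1 = w $ 1" "v $ 2 = w $ 2" "v $ 3 > w $ 3"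
proof -
  from assms obtain i where i: "i < 3" "[(v - w) $ 1, (v - w) $ 2, (v - w) $ 3] ! i > 0"
    "\<forall>j<i. [(v - w) $ 1, (v - w) $ 2, (v - w) $ 3] ! j = 0"
    by (auto simp: lex_greater_def lex_pos_def numeral_3_eq_3)
  \<comment> \<open>List positions start at 0, so position \<open>i\<close> holds component
    \<open>i + 1\<close> of the vector.\<close>
  from i(1) consider "i = 0" | "i = 1" | "i = 2" by linarith
  then show thesis
  proof cases
    case 1
    with i that(1) show thesis by simp
  next
    case 2
    with i that(2) show thesis by simp
  next
    case 3
    have "[(v - w) $ 1, (v - w) $ 2, (v - w) $ 3] ! 0 = 0" "[(v - w) $ 1, (v - w) $ 2, (v - w) $ 3] ! 1 = 0"
      using i(3)[rule_format, of 0] i(3)[rule_format, of 1] 3 by simp_all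
    with i(2) 3 that(3) show thesis by simp
  qed
qed

lemma switching_unique_outside_exceptional:
  fixes A :: "nat \<Rightarrow> real ^ 'n ^ 'n" and e :: "nat \<Rightarrow> real ^ 'n" and M :: "real ^ 3 ^ 3"
  assumes tri: "lower_triangular M" and diag: "\<forall>i. M $ i $ i > 0"
    and lin: "linear_stack c (A 1) = M ** linear_stack c (A 2)"
    and lex: "constant_stack c f (A 1) (e 1) \<succ> M *v constant_stack c f (A 2) (e 2)"
    and \<xi>: "\<xi> \<notin> exceptional_states A e c f"
  shows "switching_unique (\<lambda>x. A 1 *v x + e 1) (\<lambda>x. A 2 *v x + e 2) c f \<xi>"
proof -
  define F G where "F = (\<lambda>x. A 1 *v x + e 1)" and "G = (\<lambda>x. A 2 *v x + e 2)"
  define b1 b2 where "b1 = c v* A 1" and "b2 = c v* A 2"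
  define m21 m22 m31 m32 m33 where "m21 = M $ 2 $ 1" and "m22 = M $ 2 $ 2"
    and "m31 = M $ 3 $ 1" and "m32 = M $ 3 $ 2" and "m33 = M $ 3 $ 3"
  note m_defs = m21_def m22_def m31_def m32_def m33_def
  define d2 d3 where "d2 = c \<bullet> e 1 - (m21 * f + m22 * (c \<bullet> e 2))"
    and "d3 = b1 \<bullet> e 1 - (m31 * f + m32 * (c \<bullet> e 2) + m33 * (b2 \<bullet> e 2))"
  have m: "m22 > 0" "m33 > 0" using diag by (simp_all add: m_defs)
  have tri': "M $ 1 $ 2 = 0" "M $ 1 $ 3 = 0" "M $ 2 $ 3 = 0" using tri by (simp_all add: lower_triangular_def)
  have c: "c = M $ 1 $ 1 *\<^sub>R c"
    using arg_cong[OF lin, of "\<lambda>L. L $ 1"] tri' by (simp add: matrix_matrix_mult_row_3)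
  have b: "b1 = m21 *\<^sub>R c + m22 *\<^sub>R b2"
    using arg_cong[OF lin, of "\<lambda>L. L $ 2"] tri' by (simp add: matrix_matrix_mult_row_3 b1_def b2_def m_defs)
  have b': "c v* (A 1 ** A 1) = m31 *\<^sub>R c + m32 *\<^sub>R b2 + m33 *\<^sub>R (c v* (A 2 ** A 2))"
    using arg_cong[OF lin, of "\<lambda>L. L $ 3"] by (simp add: matrix_matrix_mult_row_3 b2_def m_defs)
  have cF: "c \<bullet> F x = b1 \<bullet> x + c \<bullet> e 1" and cG: "c \<bullet> G x = b2 \<bullet> x + c \<bullet> e 2" for x
    by (simp_all add: F_def G_def b1_def b2_def dot_lmul_matrix inner_add_right)
  have z: "c \<bullet> F x = m21 * (c \<bullet> x + f) + m22 * (c \<bullet> G x) + d2" for x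
    by (simp add: cF cG b d2_def inner_add_left algebra_simps)
  have bF: "b1 \<bullet> F x = (c v* (A 1 ** A 1)) \<bullet> x + b1 \<bullet> e 1"
    and bG: "b2 \<bullet> G x = (c v* (A 2 ** A 2)) \<bullet> x + b2 \<bullet> e 2" for x
    by (simp_all add: F_def G_def b1_def b2_def vector_matrix_square_inner)
  have w: "b1 \<bullet> F x = m31 * (c \<bullet> x + f) + m32 * (c \<bullet> G x) + m33 * (b2 \<bullet> G x) + d3" for x
    unfolding bF bG cG b' by (simp add: d3_def inner_add_left algebra_simps)
  \<comment> \<open>On vectors orthogonal to \<open>c\<close>, \<open>b1\<close> and
    \<open>b2\<close> thus differ by the positive factor \<open>m22\<close>; this transfers
    second-order signs between the modes.\<close>
  have bv: "b1 \<bullet> v = m21 * (c \<bullet> v) + m22 * (b2 \<bullet> v)" for v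
    by (simp add: b inner_add_left)
  have Fl: "bounded_lipschitz_on (cball \<xi> 1) F" and Gl: "bounded_lipschitz_on (cball \<xi> 1) G"
    unfolding F_def G_def
    by (rule bounded_lipschitz_on_affine_field[OF _ matrix_vector_mul_bounded_linear]; simp)+
  have "switching_unique F G c f \<xi>"
  proof (cases "c \<bullet> \<xi> + f = 0")
    case False
    then consider "c \<bullet> \<xi> + f > 0" | "- c \<bullet> \<xi> + - f > 0" by force
    then show ?thesis
    proof cases
      case 1
      then show ?thesis by (rule switching_unique_off_surface[OF Gl])
    next
      case 2
      then show ?thesis by (rule switching_unique_swap[OF switching_unique_off_surface[OF Fl]])
    qed
  next
    case y0: True
    \<comment> \<open>The first matrix row relates \<open>c\<close> to itself. At a surface point
      \<open>f = - (c \<bullet> \<xi>)\<close>, so the first lexicographic entries agree and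
      strictness must come from \<open>d2\<close> or \<open>d3\<close>.\<close>
    have "c \<bullet> \<xi> = M $ 1 $ 1 * (c \<bullet> \<xi>)" using arg_cong[OF c, of "\<lambda>v. v \<bullet> \<xi>"] by simp
    moreover have "c \<bullet> \<xi> = - f" using y0 by linarith
    ultimately have "f = M $ 1 $ 1 * f" by simp
    from lex have "d2 > 0 \<or> d2 = 0 \<and> d3 > 0"
      by (rule lex_greater_cases)
        (use \<open>f = M $ 1 $ 1 * f\<close> tri' in
          \<open>auto simp: matrix_vector_mult_def sum_3 d2_def d3_def m_defs b1_def b2_def\<close>)
    then have d2: "d2 \<ge> 0" and d3: "d2 = 0 \<Longrightarrow> d3 > 0" by auto
    have z\<xi>: "c \<bullet> F \<xi> = m22 * (c \<bullet> G \<xi>) + d2" using z[of \<xi>] y0 by simp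
    consider "c \<bullet> F \<xi> > c \<bullet> G \<xi>" | "c \<bullet> F \<xi> > 0" "c \<bullet> G \<xi> > 0" | "c \<bullet> F \<xi> < 0" "c \<bullet> G \<xi> < 0"
      | "c \<bullet> F \<xi> = 0" "c \<bullet> G \<xi> = 0"
    proof (cases "c \<bullet> G \<xi>" "0::real" rule: linorder_cases)
      case less
      then show thesis using that(1,3) by linarith
    next
      case equal
      then show thesis using that(1,4) z\<xi> d2 by force
    next
      case greater
      then have "c \<bullet> F \<xi> > 0" using z\<xi> d2 m(1) by (simp add: add_pos_nonneg)
      then show thesis using that(2) greater by blast
    qed
    then show ?thesis
    proof cases
      case 1
      have "bounded_linear (\<lambda>x. (A 1 - A 2) *v x)" by (rule matrix_vector_mul_bounded_linear)
      moreover have "F x - G x = (A 1 - A 2) *v x + (e 1 - e 2)" for x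
        by (simp add: F_def G_def matrix_vector_mult_diff_rdistrib)
      ultimately show ?thesis
        using y0 1 by (rule switching_unique_attractive[OF Fl Gl])
    next
      case 2
      then show ?thesis by (rule switching_unique_transversal[OF Fl Gl y0])
    next
      case 3
      have "switching_unique G F (- c) (- f) \<xi>"
        by (rule switching_unique_transversal[OF Gl Fl]) (use y0 3 in auto)
      then show ?thesis by (rule switching_unique_swap)
    next
      case 4
      then have "d2 = 0" using z\<xi> by simp
      with d3 have "d3 > 0" by simp
      have w\<xi>: "b1 \<bullet> F \<xi> = m33 * (b2 \<bullet> G \<xi>) + d3" using w[of \<xi>] y0 4 by simp
      have p: "b1 \<bullet> F \<xi> = m22 * (b2 \<bullet> F \<xi>)" and q: "b1 \<bullet> G \<xi> = m22 * (b2 \<bullet> G \<xi>)"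
        using bv 4 by simp_all
      \<comment> \<open>Otherwise \<open>b1 \<bullet> F \<xi> = d3 > 0\<close>, which puts
        \<open>\<xi>\<close> in the exceptional set with \<open>k = 1\<close> and
        \<open>j = 2\<close>. The next claim is the case \<open>k = 2\<close>,
        \<open>j = 1\<close>.\<close>
      have "b2 \<bullet> G \<xi> \<noteq> 0"
      proof
        assume "b2 \<bullet> G \<xi> = 0"
        then have "\<xi> \<in> exceptional_states A e c f"
          using y0 4 w\<xi> \<open>d3 > 0\<close> by (intro exceptional_statesI[of 1 2]) (auto simp: F_def G_def b1_def b2_def)
        with \<xi> show False ..
      qed
      moreover have "b1 \<bullet> F \<xi> \<noteq> 0"
      proof
        assume b0: "b1 \<bullet> F \<xi> = 0"
        then have "m33 * (b2 \<bullet> G \<xi>) < 0" using w\<xi> \<open>d3 > 0\<close> by linarith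
        then have "b2 \<bullet> G \<xi> < 0" using m(2) by (simp add: mult_less_0_iff)
        then have "\<xi> \<in> exceptional_states A e c f"
          using y0 4 b0 by (intro exceptional_statesI[of 2 1]) (auto simp: F_def G_def b1_def b2_def)
        with \<xi> show False ..
      qed
      moreover have "b1 \<bullet> F \<xi> > 0" if "b2 \<bullet> G \<xi> > 0"
        using w\<xi> \<open>d3 > 0\<close> m(2) that by (simp add: add_pos_pos)
      ultimately consider "b1 \<bullet> F \<xi> > 0" "b2 \<bullet> G \<xi> > 0" | "b1 \<bullet> F \<xi> < 0" "b2 \<bullet> G \<xi> < 0"
        | "b1 \<bullet> F \<xi> > 0" "b2 \<bullet> G \<xi> < 0" by linarith
      then show ?thesis
      proof cases
        case 1
        then have "b2 \<bullet> F \<xi> > 0" "b1 \<bullet> G \<xi> > 0" using p q m(1) by (auto simp: zero_less_mult_iff)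
        with 1 4 show ?thesis
          by (intro switching_unique_second_order[OF Fl Gl y0 cF cG])
      next
        case 2
        then have pq: "b2 \<bullet> F \<xi> < 0" "b1 \<bullet> G \<xi> < 0" using p q m(1) by (auto simp: mult_less_0_iff)
        \<comment> \<open>After the exchange of modes the switching function is negated, so
          \<open>- b2\<close> and \<open>- b1\<close> take the places of \<open>b1\<close> and
          \<open>b2\<close>, and all four second-order signs become positive.\<close>
        have "switching_unique G F (- c) (- f) \<xi>"
          by (rule switching_unique_second_order[OF Gl Fl, where ?b1.0="- b2" and ?b2.0="- b1" and ?k1.0="- (c \<bullet> e 2)" and ?k2.0="- (c \<bullet> e 1)"])
            (use 2 4 pq y0 cF cG in auto)
        then show ?thesis by (rule switching_unique_swap)
      next
        case 3
        then have "b2 \<bullet> F \<xi> > 0" using p m(1) by (simp add: zero_less_mult_iff)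
        \<comment> \<open>Since \<open>d2 = 0\<close>, the relation between the first derivatives is
          homogeneous; it supplies \<open>\<alpha> = m21\<close> and \<open>\<beta> = m22\<close>
          for the sliding lemma.\<close>
        moreover have "c \<bullet> F x = m21 * (c \<bullet> x + f) + m22 * (c \<bullet> G x)" for x
          using z \<open>d2 = 0\<close> by simp
        ultimately show ?thesis
          using 3 4 y0 m(1) cG
          by (intro switching_unique_second_order_sliding[of F "\<lambda>x. A 1 *v x" "e 1" G "\<lambda>x. A 2 *v x" "e 2" c \<xi> f m22 b2 "c \<bullet> e 2" m21])
            (simp_all add: F_def G_def matrix_vector_mul_bounded_linear)
      qed
    qed
  qed
  then show ?thesis by (simp add: F_def G_def)
qed

theorem theorem3p4:
  fixes A :: "nat \<Rightarrow> real ^ 'n ^ 'n" and e :: "nat \<Rightarrow> real ^ 'n"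
    and c :: "real ^ 'n" and f :: real
  assumes "\<exists>M :: real ^ 3 ^ 3.
      lower_triangular M \<and> (\<forall>i. M $ i $ i > 0) \<and>
      linear_stack c (A 1) = M ** linear_stack c (A 2) \<and>
      constant_stack c f (A 1) (e 1) \<succ> M *v constant_stack c f (A 2) (e 2)"
  shows "\<forall>\<xi> \<in> UNIV - exceptional_states A e c f.
      \<forall>x. filippov_solution A e c f \<xi> x \<longrightarrow> right_unique_solution A e c f \<xi> x"
  using assms switching_unique_outside_exceptional switching_unique_imp_right_unique by blast

end
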